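(* Assume that the closed-loop system $$\dot{x}(t)=A_{0}x(t)+A_{1}x(t-h)+\int_{-h}^{0}G(\theta)x(t+\theta)\,d\theta,\qquad t\ge0,$$ is exponentially stable, let $K(t)$ be its fundamental matrix and $U(\tau,M)=\int_0^\infty K^T(t)MK(t+\tau)\,dt$ its delay Lyapunov matrix function. Let $M_1=Q+\Gamma_0^TR\Gamma_0$, $M_2(\theta)=\Gamma_0^TR\Gamma_1(\theta)$, $M_3(\theta_1,\theta_2)=\Gamma_1^T(\theta_1)R\Gamma_1(\theta_2)$ for $\theta,\theta_1,\theta_2\in[-h,0]$, and $$\hat K(t,\theta)=K(t-\theta-h)A_1+\int_{-h}^{\theta}K(t-\theta+\xi)G(\xi)\,d\xi .$$ Define, for $\xi,\theta\in[-h,0]$, $$\Pi_0=\int_0^\infty K^T(t)M_1K(t)\,dt+2\int_0^\infty\int_{-h}^0K^T(t)M_2(\theta)K(t+\theta)\,d\theta\,dt+\int_0^\infty\int_{-h}^0\int_{-h}^0K^T(t+\theta_1)M_3(\theta_1,\theta_2)K(t+\theta_2)\,d\theta_1\,d\theta_2\,dt,$$ $$\begin{aligned}\Pi_1(\theta)=&\int_0^\infty K^T(t)M_1\hat K(t,\theta)\,dt+\int_{-h}^0\int_0^\infty K^T(t)\left(M_2(\theta_2)\hat K(t+\theta_2,\theta)+M_2^T(\theta_2)\hat K(t-\theta_2,\theta)\right)dt\,d\theta_2\\&+\int_{-h}^0\int_{-h}^0\int_0^\infty K^T(t+\theta_1)M_3(\theta_1,\theta_2)\hat K(t+\theta_2,\theta)\,dt\,d\theta_1\,d\theta_2,\end{aligned}$$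 $$\begin{aligned}\Pi_2(\xi,\theta)=&\int_0^\infty\hat K^T(t,\xi)M_1\hat K(t,\theta)\,dt+2\int_{-h}^0\int_0^\infty\hat K^T(t,\xi)M_2(\theta_2)\hat K(t+\theta_2,\theta)\,dt\,d\theta_2\\&+\int_{-h}^0\int_{-h}^0\int_0^\infty\hat K^T(t+\theta_1,\xi)M_3(\theta_1,\theta_2)\hat K(t+\theta_2,\theta)\,dt\,d\theta_1\,d\theta_2.\end{aligned}$$ Then these matrices can be expressed as $$\Pi_0=U(0,M_1)+2\int_{-h}^0U(\theta,M_2(\theta))\,d\theta+\int_{-h}^0\int_{-h}^0U(-\theta_1+\theta_2,M_3(\theta_1,\theta_2))\,d\theta_1\,d\theta_2,$$ $$\begin{aligned}\Pi_1(\theta)=&\,U(-\theta-h,M_1)A_1+\int_{-h}^\theta U(-\theta+\delta,M_1)G(\delta)\,d\delta+\int_{-h}^0U(\theta_2-\theta-h,M_2(\theta_2))\,d\theta_2A_1\\&+\int_{-h}^0U(-\theta_2-\theta-h,M_2^T(\theta_2))\,d\theta_2A_1+\int_{-h}^0\int_{-h}^\theta U(\theta_2-\theta+\delta,M_2(\theta_2))G(\delta)\,d\delta\,d\theta_2\\&+\int_{-h}^0\int_{-h}^\theta U(-\theta_2-\theta+\delta,M_2^T(\theta_2))G(\delta)\,d\delta\,d\theta_2+\int_{-h}^0\int_{-h}^0U(-\theta_1+\theta_2-\theta-h,M_3(\theta_1,\theta_2))\,d\theta_1\,d\theta_2A_1\\&+\int_{-h}^0\int_{-h}^0\int_{-h}^\theta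 U(-\theta_1+\theta_2-\theta+\delta,M_3(\theta_1,\theta_2))G(\delta)\,d\delta\,d\theta_1\,d\theta_2,\end{aligned}$$ $$\begin{aligned}\Pi_2(\xi,\theta)=&\,A_1^TU(\xi-\theta,M_1)A_1+A_1^T\int_{-h}^\theta U(\xi+h-\theta+\delta,M_1)G(\delta)\,d\delta+\int_{-h}^\xi G^T(\delta)U(\xi-\delta-\theta-h,M_1)A_1\,d\delta\\&+\int_{-h}^\xi\int_{-h}^\theta G^T(\delta_1)U(\xi-\theta-\delta_1+\delta_2,M_1)G(\delta_2)\,d\delta_2\,d\delta_1+2A_1^T\int_{-h}^0U(\xi+\theta_2-\theta,M_2(\theta_2))\,d\theta_2A_1\\&+2A_1^T\int_{-h}^0\int_{-h}^\theta U(\xi+h+\theta_2-\theta+\delta,M_2(\theta_2))G(\delta)\,d\delta\,d\theta_2\\&+2\int_{-h}^0\int_{-h}^\xi G^T(\delta)U(\xi-\delta+\theta_2-\theta-h,M_2(\theta_2))\,d\delta\,d\theta_2A_1\\&+2\int_{-h}^0\int_{-h}^\xi\int_{-h}^\theta G^T(\delta_1)U(\xi-\delta_1+\theta_2-\theta+\delta_2,M_2(\theta_2))G(\delta_2)\,d\delta_2\,d\delta_1\,d\theta_2\\&+A_1^T\int_{-h}^0\int_{-h}^0U(-\theta_1+\xi+\theta_2-\theta,M_3(\theta_1,\theta_2))\,d\theta_1\,d\theta_2A_1\\&+A_1^T\int_{-h}^0\int_{-h}^0\int_{-h}^\theta U(-\theta_1+\xi+h+\theta_2-\theta+\delta,M_3(\theta_1,\theta_2))G(\delta)\,d\delta\,d\theta_1\,d\theta_2\\&+\int_{-h}^0\int_{-h}^0\int_{-h}^\xi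 G^T(\delta)U(-\theta_1+\xi-\delta+\theta_2-\theta-h,M_3(\theta_1,\theta_2))\,d\delta\,d\theta_1\,d\theta_2A_1\\&+\int_{-h}^0\int_{-h}^0\int_{-h}^\xi\int_{-h}^\theta G^T(\delta_1)U(-\theta_1+\xi-\delta_1+\theta_2-\theta+\delta_2,M_3(\theta_1,\theta_2))G(\delta_2)\,d\delta_2\,d\delta_1\,d\theta_1\,d\theta_2.\end{aligned}$$
   Context: The closed-loop system arises from $\dot x(t)=Ax(t)+Bx(t-h)+\int_{-h}^0E(\theta)x(t+\theta)\,d\theta+Du(t)$ with the linear control $u_L(x_t)=\Gamma_0x(t)+\int_{-h}^0\Gamma_1(\theta)x(t+\theta)\,d\theta$, so that $A_0=A+D\Gamma_0$, $A_1=B$, $G(\theta)=E(\theta)+D\Gamma_1(\theta)$. Here $h>0$; $A,B\in\mathbb{R}^{n\times n}$, $D\in\mathbb{R}^{n\times r}$ are constant; $E$ is a continuous $n\times n$ matrix function on $[-h,0]$; $\Gamma_0\in\mathbb{R}^{r\times n}$; $\Gamma_1$ is an $r\times n$ matrix function on $[-h,0]$ (such that the integrals involving it are defined); $Q\in\mathbb{R}^{n\times n}$ and $R\in\mathbb{R}^{r\times r}$ are symmetric positive definite. The fundamental matrix $K(t)$ is the $n\times n$ matrix function satisfying $\dot K(t)=K(t)A_0+K(t-h)A_1+\int_{-h}^0K(t+\theta)G(\theta)\,d\theta$ for $t\ge0$, with $K(0)=I$ and $K(t)=0$ for $t<0$. Exponential stability gives $\|K(t)\|\le\gamma e^{-\beta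 t}$ for $t\ge0$ with some $\gamma,\beta>0$. For a constant matrix $M\in\mathbb{R}^{n\times n}$, $U(\tau,M)$ is defined for all $\tau\in\mathbb{R}$ by the integral given in the claim. *)

theory Defs
  imports "HOL-Analysis.Analysis"
begin

text \<open>
  Linear systems with a discrete delay \<open>h\<close> and a distributed delay with kernel \<open>G\<close>:
  \<open>x'(t) = A0 x(t) + A1 x(t - h) + \<integral>\<^bsub>[-h,0]\<^esub> G(\<theta>) x(t + \<theta>) d\<theta>\<close>.
  All integrals are Lebesgue integrals; in iterated integrals the outermost binder is the
  variable whose differential is written last.
\<close>

definition sym_pos_def :: "real^'n^'n \<Rightarrow> bool" where
  "sym_pos_def Q \<longleftrightarrow> transpose Q = Q \<and> (\<forall>x. x \<noteq> 0 \<longrightarrow> x \<bullet> (Q *v x) > 0)"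

text \<open>
  The initial function of a solution is its (continuous) restriction to \<open>[-h, 0]\<close>. For such a
  solution the right-hand side of the equation is continuous in \<open>t\<close>, so the derivative exists in
  the ordinary sense for \<open>t > 0\<close> and as a one-sided derivative at \<open>0\<close>.
\<close>

definition delay_solution ::
  "real \<Rightarrow> real^'n^'n \<Rightarrow> real^'n^'n \<Rightarrow> (real \<Rightarrow> real^'n^'n) \<Rightarrow> (real \<Rightarrow> real^'n) \<Rightarrow> bool" where
  "delay_solution h A0 A1 G x \<longleftrightarrow>
     continuous_on {-h..} x \<and>
     (\<forall>t\<ge>0. (x has_vector_derivative
        (A0 *v x t + A1 *v x (t - h) + (LINT \<theta>:{-h..0}|lebesgue. G \<theta> *v x (t + \<theta>))))
        (at t within {0..}))"

definition exp_stable ::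
  "real \<Rightarrow> real^'n^'n \<Rightarrow> real^'n^'n \<Rightarrow> (real \<Rightarrow> real^'n^'n) \<Rightarrow> bool" where
  "exp_stable h A0 A1 G \<longleftrightarrow>
     (\<exists>\<gamma>>0. \<exists>\<beta>>0. \<forall>x. delay_solution h A0 A1 G x \<longrightarrow>
        (\<forall>t\<ge>0. norm (x t) \<le> \<gamma> * exp (- \<beta> * t) * (SUP \<theta>\<in>{-h..0}. norm (x \<theta>))))"

text \<open>
  The fundamental matrix jumps at \<open>t = 0\<close>, hence the term \<open>K(t - h) A1\<close> jumps at \<open>t = h\<close>, where
  \<open>K\<close> in general has no two-sided derivative. As usual the equation is therefore read with the
  right derivative, for a \<open>K\<close> continuous on \<open>[0, \<infinity>)\<close>.
\<close>

definition fundamental_matrix ::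
  "real \<Rightarrow> real^'n^'n \<Rightarrow> real^'n^'n \<Rightarrow> (real \<Rightarrow> real^'n^'n) \<Rightarrow> (real \<Rightarrow> real^'n^'n) \<Rightarrow> bool" where
  "fundamental_matrix h A0 A1 G K \<longleftrightarrow>
     (\<forall>t<0. K t = 0) \<and> K 0 = mat 1 \<and> continuous_on {0..} K \<and>
     (\<forall>t\<ge>0. (K has_vector_derivative
        (K t ** A0 + K (t - h) ** A1 + (LINT \<theta>:{-h..0}|lebesgue. K (t + \<theta>) ** G \<theta>)))
        (at_right t))"

definition lyap_matrix ::
  "(real \<Rightarrow> real^'n^'n) \<Rightarrow> real \<Rightarrow> real^'n^'n \<Rightarrow> real^'n^'n" where
  "lyap_matrix K \<tau> M = (LINT t:{0..}|lebesgue. transpose (K t) ** M ** K (t + \<tau>))"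

definition Khat ::
  "real \<Rightarrow> real^'n^'n \<Rightarrow> (real \<Rightarrow> real^'n^'n) \<Rightarrow> (real \<Rightarrow> real^'n^'n) \<Rightarrow> real \<Rightarrow> real \<Rightarrow> real^'n^'n"
  where
  "Khat h A1 G K t \<theta> =
     K (t - \<theta> - h) ** A1 + (LINT \<xi>:{-h..\<theta>}|lebesgue. K (t - \<theta> + \<xi>) ** G \<xi>)"

definition Pi0 ::
  "real \<Rightarrow> (real \<Rightarrow> real^'n^'n) \<Rightarrow>
   real^'n^'n \<Rightarrow> (real \<Rightarrow> real^'n^'n) \<Rightarrow> (real \<Rightarrow> real \<Rightarrow> real^'n^'n) \<Rightarrow> real^'n^'n" where
  "Pi0 h K M1 M2 M3 =
     (LINT t:{0..}|lebesgue. transpose (K t) ** M1 ** K t)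
     + 2 *\<^sub>R (LINT t:{0..}|lebesgue. LINT \<theta>:{-h..0}|lebesgue.
         transpose (K t) ** M2 \<theta> ** K (t + \<theta>))
     + (LINT t:{0..}|lebesgue. LINT \<theta>2:{-h..0}|lebesgue. LINT \<theta>1:{-h..0}|lebesgue.
         transpose (K (t + \<theta>1)) ** M3 \<theta>1 \<theta>2 ** K (t + \<theta>2))"

definition Pi1 ::
  "real \<Rightarrow> real^'n^'n \<Rightarrow> (real \<Rightarrow> real^'n^'n) \<Rightarrow> (real \<Rightarrow> real^'n^'n) \<Rightarrow>
   real^'n^'n \<Rightarrow> (real \<Rightarrow> real^'n^'n) \<Rightarrow> (real \<Rightarrow> real \<Rightarrow> real^'n^'n) \<Rightarrow> real \<Rightarrow> real^'n^'n" where
  "Pi1 h A1 G K M1 M2 M3 \<theta> =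
     (LINT t:{0..}|lebesgue. transpose (K t) ** M1 ** Khat h A1 G K t \<theta>)
     + (LINT \<theta>2:{-h..0}|lebesgue. LINT t:{0..}|lebesgue.
         transpose (K t) ** (M2 \<theta>2 ** Khat h A1 G K (t + \<theta>2) \<theta>
           + transpose (M2 \<theta>2) ** Khat h A1 G K (t - \<theta>2) \<theta>))
     + (LINT \<theta>2:{-h..0}|lebesgue. LINT \<theta>1:{-h..0}|lebesgue. LINT t:{0..}|lebesgue.
         transpose (K (t + \<theta>1)) ** M3 \<theta>1 \<theta>2 ** Khat h A1 G K (t + \<theta>2) \<theta>)"

definition Pi2 ::
  "real \<Rightarrow> real^'n^'n \<Rightarrow> (real \<Rightarrow> real^'n^'n) \<Rightarrow> (real \<Rightarrow> real^'n^'n) \<Rightarrow>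
   real^'n^'n \<Rightarrow> (real \<Rightarrow> real^'n^'n) \<Rightarrow> (real \<Rightarrow> real \<Rightarrow> real^'n^'n) \<Rightarrow>
   real \<Rightarrow> real \<Rightarrow> real^'n^'n" where
  "Pi2 h A1 G K M1 M2 M3 \<xi> \<theta> =
     (LINT t:{0..}|lebesgue. transpose (Khat h A1 G K t \<xi>) ** M1 ** Khat h A1 G K t \<theta>)
     + 2 *\<^sub>R (LINT \<theta>2:{-h..0}|lebesgue. LINT t:{0..}|lebesgue.
         transpose (Khat h A1 G K t \<xi>) ** M2 \<theta>2 ** Khat h A1 G K (t + \<theta>2) \<theta>)
     + (LINT \<theta>2:{-h..0}|lebesgue. LINT \<theta>1:{-h..0}|lebesgue. LINT t:{0..}|lebesgue.
         transpose (Khat h A1 G K (t + \<theta>1) \<xi>) ** M3 \<theta>1 \<theta>2 ** Khat h A1 G K (t + \<theta>2) \<theta>)"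

end

theory Submission
  imports Defs
begin

text \<open>
  The formulas come from moving every integral in the delay variables outside the integral over
  time. What remains inside is \<open>\<integral> K(t + a)\<^sup>T M K(t + s) dt\<close> over \<open>t \<ge> 0\<close>. Since \<open>K\<close> vanishes on the
  negative axis, substituting \<open>t - a\<close> for \<open>t\<close> turns it into \<open>U(s - a, M)\<close> as soon as \<open>a \<le> 0\<close>
  (\<open>correlation_shift\<close>), and in the claim the shift of the left factor is always of this sign: it is
  built from \<open>\<theta>1 \<le> 0\<close>, \<open>- \<xi> - h \<le> 0\<close> and \<open>\<delta> - \<xi> \<le> 0\<close> for \<open>\<delta> \<in> [-h, \<xi>]\<close>.

  All interchanges of integrals need \<open>K\<close> to be bounded and integrable, and this is the analytic
  core. Exponential stability speaks about continuous solutions of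
  \<open>x' = A0 x + A1 x(t - h) + \<integral> G x\<close>, where the coefficients act from the left; the fundamental
  matrix jumps at \<open>0\<close> and is defined by the equation with the coefficients on the right. Write
  \<open>*\<close> for convolution of functions that vanish on the negative axis, \<open>1\<close> for the unit step, and
  \<open>L\<close>, \<open>R\<close> for the results of applying the delay operator to \<open>K\<close> from the left and from the
  right. The definition of \<open>K\<close> says \<open>K = 1 + 1 * R\<close>, and \<open>R * K = K * L\<close> because the coefficients
  can be moved from one factor of a convolution to the other. Inserting the first equation into
  \<open>K * K\<close> and using that \<open>1\<close> commutes with every factor, \<open>H = K - 1 - 1 * L\<close> satisfies
  \<open>K * H = 0\<close>, so that \<open>P = 1 * H\<close> solves the homogeneous Volterra equation \<open>P = - R * P\<close>. Gronwall's
  inequality gives \<open>P = 0\<close>, hence \<open>H = 0\<close>, which is the left equation (\<open>K_eq_left\<close>). The columns of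
  \<open>K(t + h)\<close> are therefore continuous solutions, and stability applies to them
  (\<open>exponential_decay\<close>).

  The algebra is organised by treating \<open>U\<close> and everything derived from it as a kernel
  \<open>\<Phi>(\<tau>, M)\<close> that is Borel in both arguments and at most proportional to the norm of \<open>M\<close>. The
  three terms of each cost matrix are the values at one such kernel of functionals like
  \<open>\<Phi> \<mapsto> \<integral>\<integral> \<Phi>(\<theta>2 - \<theta>1, M3(\<theta>1, \<theta>2))\<close>, which are additive and commute with constant matrix factors
  on either side. The kernel is \<open>U\<close> itself for \<open>\<Pi>0\<close>, the correlation of \<open>K\<close> with \<open>Khat\<close>, a sum
  of two simpler kernels, for \<open>\<Pi>1\<close>, and the correlation of \<open>Khat\<close> with \<open>Khat\<close>, a sum of four,
  for \<open>\<Pi>2\<close>. Each functional turns these sums of kernels into the two or four summands that its term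
  contributes to the claim.
\<close>

section \<open>Matrix norms, measurability and Fubini\<close>

text \<open>
  The norm is the Euclidean norm of all entries, so this is the submultiplicativity of the
  Frobenius norm: each row of the product is a combination of the rows of \<open>B\<close>, and Cauchy-Schwarz
  bounds it.
\<close>

lemma norm_matrix_mult_le:
  fixes A :: "real^'m^'l" and B :: "real^'n^'m"
  shows "norm (A ** B) \<le> norm A * norm B"
proof -
  have row: "norm ((A ** B) $ i) \<le> norm (A $ i) * norm B" for i
  proof -
    have "(A ** B) $ i = (\<Sum>k\<in>UNIV. (A $ i $ k) *\<^sub>R (B $ k))"
      by (simp add: matrix_matrix_mult_def vec_eq_iff)
    then have "norm ((A ** B) $ i) \<le> (\<Sum>k\<in>UNIV. norm ((A $ i $ k) *\<^sub>R (B $ k)))"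
      by (simp only: norm_sum)
    also have "\<dots> = (\<Sum>k\<in>UNIV. \<bar>A $ i $ k\<bar> * \<bar>norm (B $ k)\<bar>)"
      by simp
    also have "\<dots> \<le> L2_set (\<lambda>k. A $ i $ k) UNIV * L2_set (\<lambda>k. norm (B $ k)) UNIV"
      by (rule L2_set_mult_ineq)
    also have "\<dots> = norm (A $ i) * norm B"
      by (simp add: norm_vec_def L2_set_def)
    finally show ?thesis .
  qed
  have "norm (A ** B) \<le> L2_set (\<lambda>i. norm B * norm (A $ i)) UNIV"
    unfolding norm_vec_def[of "A ** B"]
    by (rule L2_set_mono) (use row in \<open>auto simp: mult.commute\<close>)
  also have "\<dots> = norm B * norm A"
    by (simp add: L2_set_right_distrib norm_vec_def[of A])
  finally show ?thesis
    by (simp add: mult.commute)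
qed

lemma norm_matrix_mult_le_left:
  fixes A :: "real^'m^'l" and B :: "real^'n^'m"
  shows "norm B \<le> y \<Longrightarrow> norm (A ** B) \<le> norm A * y"
  by (rule order_trans[OF norm_matrix_mult_le mult_left_mono]) auto

lemma norm_matrix_mult_le_right:
  fixes A :: "real^'m^'l" and B :: "real^'n^'m"
  shows "norm A \<le> x \<Longrightarrow> norm (A ** B) \<le> x * norm B"
  by (rule order_trans[OF norm_matrix_mult_le mult_right_mono]) auto

lemma bounded_bilinear_matrix_mult:
  "bounded_bilinear (\<lambda>(A :: real^'m^'l) (B :: real^'n^'m). A ** B)"
proof
  show "\<exists>K. \<forall>(A :: real^'m^'l) (B :: real^'n^'m). norm (A ** B) \<le> norm A * norm B * K"
    by (rule exI[of _ 1]) (simp add: norm_matrix_mult_le)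
qed (simp_all add: matrix_matrix_mult_def vec_eq_iff
      sum_distrib_left sum.distrib distrib_left distrib_right ac_simps)

interpretation mm: bounded_bilinear "\<lambda>(A :: real^'m^'l) (B :: real^'n^'m). A ** B"
  by (rule bounded_bilinear_matrix_mult)

lemma bounded_linear_transpose: "bounded_linear (transpose :: real^'m^'l \<Rightarrow> real^'l^'m)"
  by (rule linear_conv_bounded_linear[THEN iffD1], rule linearI)
     (simp_all add: transpose_def vec_eq_iff)

lemma norm_transpose [simp]:
  fixes A :: "real^'m^'l"
  shows "norm (transpose A) = norm A"
proof -
  have "(norm (transpose A))\<^sup>2 = (norm A)\<^sup>2"
    unfolding norm_vec_def L2_set_def
    by (simp add: sum_nonneg transpose_def) (rule sum.swap)
  then show ?thesis by simp
qed

lemma transpose_add: "transpose (A + B :: real^'m^'l) = transpose A + transpose B"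
  by (rule linear_add[OF bounded_linear.linear[OF bounded_linear_transpose]])

lemma transpose_zero [simp]: "transpose (0 :: real^'m^'l) = 0"
  by (simp add: transpose_def vec_eq_iff)

lemma norm_mult3_le:
  fixes A :: "real^'m^'l" and B :: "real^'k^'m" and C :: "real^'n^'k"
  shows "norm (A ** B ** C) \<le> norm A * norm B * norm C"
  by (meson norm_matrix_mult_le order_trans mult_right_mono norm_ge_zero)

lemma borel_measurable_matrix_mult [measurable (raw)]:
  fixes f :: "'a \<Rightarrow> real^'m^'l" and g :: "'a \<Rightarrow> real^'n^'m"
  assumes "f \<in> borel_measurable M" "g \<in> borel_measurable M"
  shows "(\<lambda>x. f x ** g x) \<in> borel_measurable M"
  by (rule borel_measurable_continuous_Pair[OF assms]) (intro mm.continuous_on continuous_intros)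

lemma borel_measurable_transpose [measurable (raw)]:
  fixes f :: "'a \<Rightarrow> real^'m^'l"
  assumes "f \<in> borel_measurable M"
  shows "(\<lambda>x. transpose (f x)) \<in> borel_measurable M"
  by (rule measurable_compose[OF assms])
     (intro borel_measurable_continuous_onI linear_continuous_on bounded_linear_transpose)

text \<open>
  Integrals over a set become integrals with respect to the restricted measure, to which the
  theorems on products of sigma-finite measures apply directly.
\<close>

abbreviation leb_on :: "real set \<Rightarrow> real measure" where
  "leb_on S \<equiv> restrict_space lebesgue S"

lemma sigma_finite_lebesgue: "sigma_finite_measure (lebesgue :: real measure)"
proof
  obtain A :: "real set set" where A: "countable A" "A \<subseteq> sets lborel" "\<Union>A = space lborel"
    "\<forall>a\<in>A. emeasure lborel a \<noteq> \<infinity>"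
    using lborel.sigma_finite_countable by blast
  have "A \<subseteq> sets lebesgue \<and> (\<forall>a\<in>A. emeasure lebesgue a \<noteq> \<infinity>)"
    using A(2,4) by (auto simp: emeasure_completion subset_iff)
  with A show "\<exists>A. countable A \<and> A \<subseteq> sets lebesgue \<and> \<Union>A = space (lebesgue :: real measure)
      \<and> (\<forall>a\<in>A. emeasure lebesgue a \<noteq> \<infinity>)"
    by (intro exI[of _ A]) auto
qed

lemma sigma_finite_leb_on:
  "S \<in> sets lebesgue \<Longrightarrow> sigma_finite_measure (leb_on S)"
  by (rule sigma_finite_measure_restrict_space[OF sigma_finite_lebesgue])

lemma set_lint_leb_on:
  fixes f :: "real \<Rightarrow> 'a::{banach, second_countable_topology}"
  assumes "S \<in> sets lebesgue"
  shows "(LINT x:S|lebesgue. f x) = integral\<^sup>L (leb_on S) f"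
  using assms by (simp add: set_lebesgue_integral_def integral_restrict_space)

lemma set_integrable_leb_on:
  fixes f :: "real \<Rightarrow> 'a::{banach, second_countable_topology}"
  assumes "S \<in> sets lebesgue"
  shows "set_integrable lebesgue S f \<longleftrightarrow> integrable (leb_on S) f"
  using assms by (simp add: set_integrable_def integrable_restrict_space)

lemma measurable_ident_leb_on [measurable]:
  "(\<lambda>x. x) \<in> borel_measurable (leb_on S)"
  by (intro measurable_restrict_space1) (simp add: measurable_completion)

lemma integrable_dominated:
  fixes f :: "'a \<Rightarrow> 'b::{banach, second_countable_topology}"
  assumes "integrable M u" "f \<in> borel_measurable M" "\<And>x. x \<in> space M \<Longrightarrow> norm (f x) \<le> u x"
  shows "integrable M f"
  by (rule Bochner_Integration.integrable_bound[OF assms(1,2)])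
     (use assms(3) in \<open>auto intro!: AE_I2 intro: order_trans[OF _ abs_ge_self]\<close>)

text \<open>
  A majorant of product form supplies Fubini's theorem and all integrability facts around it. Every
  exchange of integrals below is an instance: in the time variable the majorant comes from the decay
  of \<open>K\<close> or from a bounded support, in the delay variables from the integrability of \<open>G\<close> and of
  the weights.
\<close>

lemma integrable_product_dominated:
  fixes f :: "'a \<Rightarrow> 'b \<Rightarrow> 'c::{banach, second_countable_topology}"
  assumes "sigma_finite_measure M" "sigma_finite_measure N"
    and f [measurable]: "(\<lambda>(x, y). f x y) \<in> borel_measurable (M \<Otimes>\<^sub>M N)"
    and u: "integrable M u" and v: "integrable N v"
    and bound: "\<And>x y. x \<in> space M \<Longrightarrow> y \<in> space N \<Longrightarrow> norm (f x y) \<le> u x * v y"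
  shows "integrable (M \<Otimes>\<^sub>M N) (\<lambda>(x, y). f x y)"
    and "(\<integral>x. (\<integral>y. f x y \<partial>N) \<partial>M) = (\<integral>y. (\<integral>x. f x y \<partial>M) \<partial>N)"
    and "integrable M (\<lambda>x. \<integral>y. f x y \<partial>N)"
    and "\<And>x. x \<in> space M \<Longrightarrow> integrable N (f x)"
proof -
  interpret pair_sigma_finite M N
    using assms by (simp add: pair_sigma_finite_def)
  have [measurable]: "u \<in> borel_measurable M" "v \<in> borel_measurable N"
    using u v by auto
  have sect: "f x \<in> borel_measurable N" if "x \<in> space M" for x
    using measurable_compose[OF measurable_Pair1'[OF that] f] by simp
  have "integrable (M \<Otimes>\<^sub>M N) (\<lambda>p. u (fst p) * v (snd p))"
  proof (rule Fubini_integrable)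
    have "(\<lambda>x. \<integral>y. norm (u (fst (x, y)) * v (snd (x, y))) \<partial>N)
        = (\<lambda>x. norm (u x) * (\<integral>y. norm (v y) \<partial>N))"
      by (auto simp: abs_mult)
    then show "integrable M (\<lambda>x. \<integral>y. norm (u (fst (x, y)) * v (snd (x, y))) \<partial>N)"
      using u by simp
  qed (use u v in auto)
  then show int: "integrable (M \<Otimes>\<^sub>M N) (\<lambda>(x, y). f x y)"
    by (rule integrable_dominated) (auto simp: space_pair_measure bound)
  show "(\<integral>x. (\<integral>y. f x y \<partial>N) \<partial>M) = (\<integral>y. (\<integral>x. f x y \<partial>M) \<partial>N)"
    by (rule Fubini_integral[OF int, symmetric])
  show "integrable M (\<lambda>x. \<integral>y. f x y \<partial>N)"
    using integrable_fst'[OF int] by simp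
  show "integrable N (f x)" if "x \<in> space M" for x
    by (rule integrable_dominated[where u = "\<lambda>y. u x * v y"])
       (use v that in \<open>auto simp: sect bound\<close>)
qed

section \<open>Convolution of causal matrix functions\<close>

text \<open>
  For two such functions the convolution at \<open>t\<close> only sees the compact interval \<open>[0, t]\<close>, so that a
  local bound suffices for its existence and for Fubini's theorem, before any decay is known.
\<close>

definition causal :: "(real \<Rightarrow> 'a::real_normed_vector) \<Rightarrow> bool" where
  "causal f \<longleftrightarrow> f \<in> borel_measurable borel \<and> (\<forall>t<0. f t = 0) \<and> (\<forall>T. \<exists>B\<ge>0. \<forall>t\<le>T. norm (f t) \<le> B)"

lemma causal_measurable: "causal f \<Longrightarrow> f \<in> borel_measurable borel"
  and causal_neg: "causal f \<Longrightarrow> t < 0 \<Longrightarrow> f t = 0"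
  and causal_bound: "causal f \<Longrightarrow> \<exists>B\<ge>0. \<forall>t\<le>T. norm (f t) \<le> B"
  by (auto simp: causal_def)

lemma causal_add:
  fixes f g :: "real \<Rightarrow> 'a::{real_normed_vector, second_countable_topology}"
  assumes "causal f" "causal g"
  shows "causal (\<lambda>t. f t + g t)"
  unfolding causal_def
proof (intro conjI allI)
  show "(\<lambda>t. f t + g t) \<in> borel_measurable borel"
    using assms by (intro borel_measurable_add causal_measurable)
  fix T :: real
  obtain B C where "B \<ge> 0" "\<forall>t\<le>T. norm (f t) \<le> B" "C \<ge> 0" "\<forall>t\<le>T. norm (g t) \<le> C"
    using assms[THEN causal_bound, of T] by blast
  then show "\<exists>B\<ge>0. \<forall>t\<le>T. norm (f t + g t) \<le> B"
    by (intro exI[of _ "B + C"]) (auto intro!: norm_triangle_mono)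
qed (use assms in \<open>simp add: causal_neg\<close>)

lemma causal_uminus:
  fixes f :: "real \<Rightarrow> 'a::{real_normed_vector, second_countable_topology}"
  shows "causal f \<Longrightarrow> causal (\<lambda>t. - f t)"
  by (simp add: causal_def borel_measurable_uminus)

lemma causal_diff:
  fixes f g :: "real \<Rightarrow> 'a::{real_normed_vector, second_countable_topology}"
  assumes "causal f" "causal g"
  shows "causal (\<lambda>t. f t - g t)"
  using causal_add[OF assms(1) causal_uminus[OF assms(2)]] by simp

lemma causal_delay_mult:
  fixes f :: "real \<Rightarrow> real^'n^'n"
  assumes "causal f" "c \<ge> 0"
  shows "causal (\<lambda>t. f (t - c) ** A)" "causal (\<lambda>t. A ** f (t - c))"
proof -
  note [measurable] = causal_measurable[OF assms(1)]
  have bd: "\<exists>B\<ge>0. \<forall>t\<le>T. norm (f (t - c) ** A) \<le> B \<and> norm (A ** f (t - c)) \<le> B" for T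
  proof -
    obtain B where "B \<ge> 0" "\<forall>s\<le>T. norm (f s) \<le> B"
      using causal_bound[OF assms(1)] by blast
    then have "norm (f (t - c) ** A) \<le> B * norm A \<and> norm (A ** f (t - c)) \<le> B * norm A"
      if "t \<le> T" for t
      using that assms(2)
      by (auto intro!: order_trans[OF norm_matrix_mult_le] mult_right_mono
          simp: mult.commute[of _ "norm A"] mult_left_mono)
    with \<open>B \<ge> 0\<close> show ?thesis by (intro exI[of _ "B * norm A"]) auto
  qed
  show "causal (\<lambda>t. f (t - c) ** A)" "causal (\<lambda>t. A ** f (t - c))"
    unfolding causal_def
    by (intro conjI allI impI; use bd assms in \<open>(simp add: causal_neg | meson)+\<close>)+
qed

definition matrix_conv :: "(real \<Rightarrow> real^'n^'n) \<Rightarrow> (real \<Rightarrow> real^'n^'n) \<Rightarrow> real \<Rightarrow> real^'n^'n" where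
  "matrix_conv f g t = (\<integral>s. f (t - s) ** g s \<partial>lborel)"

lemma integrable_box: "integrable lborel (\<lambda>s::real. c * indicator {a..b} s :: real)"
  by (intro integrable_mult_right integrable_real_indicator)
      (auto intro: le_less_trans[OF _ less_top[THEN iffD1]] simp: emeasure_lborel_Icc_eq)

lemma matrix_conv_dom:
  fixes f g :: "real \<Rightarrow> real^'n^'n"
  assumes "causal f" "causal g"
  obtains B where "B \<ge> 0" "\<And>t s. t \<le> T \<Longrightarrow> norm (f (t - s) ** g s) \<le> B * indicator {0..t} s"
proof -
  obtain B C where *: "B \<ge> 0" "\<forall>t\<le>T. norm (f t) \<le> B" "C \<ge> 0" "\<forall>t\<le>T. norm (g t) \<le> C"
    using assms[THEN causal_bound, of T] by blast
  show thesis
  proof (rule that[of "B * C"])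
    show "norm (f (t - s) ** g s) \<le> B * C * indicator {0..t} s" if "t \<le> T" for t s
    proof (cases "0 \<le> s \<and> s \<le> t")
      case True
      then show ?thesis
        using * that by (auto intro!: order_trans[OF norm_matrix_mult_le] mult_mono)
    next
      case False
      then have "f (t - s) = 0 \<or> g s = 0"
        using assms[THEN causal_neg] by auto
      then show ?thesis using * by auto
    qed
  qed (use * in auto)
qed

lemma matrix_conv_integrable:
  fixes f g :: "real \<Rightarrow> real^'n^'n"
  assumes "causal f" "causal g"
  shows "integrable lborel (\<lambda>s. f (t - s) ** g s)"
proof -
  obtain B where B: "\<And>u s. u \<le> t \<Longrightarrow> norm (f (u - s) ** g s) \<le> B * indicator {0..u} s"
    using matrix_conv_dom[OF assms] by blast
  note [measurable] = assms[THEN causal_measurable]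
  show ?thesis
    by (rule integrable_dominated[OF integrable_box[of B 0 t]]) (use B in auto)
qed

lemma causal_matrix_conv:
  assumes "causal f" "causal g"
  shows "causal (matrix_conv f g)"
  unfolding causal_def
proof (intro conjI allI impI)
  note [measurable] = assms[THEN causal_measurable]
  show "matrix_conv f g \<in> borel_measurable borel"
    unfolding matrix_conv_def by measurable
  show "matrix_conv f g t = 0" if "t < 0" for t
  proof -
    have "(\<lambda>s. f (t - s) ** g s) = (\<lambda>s. 0)"
    proof
      fix s show "f (t - s) ** g s = 0"
        using assms[THEN causal_neg] that by (cases "s < 0") auto
    qed
    then show ?thesis by (simp add: matrix_conv_def)
  qed
  fix T :: real
  obtain B where B: "B \<ge> 0" "\<And>u s. u \<le> T \<Longrightarrow> norm (f (u - s) ** g s) \<le> B * indicator {0..u} s"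
    using matrix_conv_dom[OF assms] by blast
  have "norm (matrix_conv f g t) \<le> B * max 0 T" if "t \<le> T" for t
  proof -
    have "norm (matrix_conv f g t) \<le> (\<integral>s. B * indicator {0..t} s \<partial>lborel)"
      unfolding matrix_conv_def
      by (rule Bochner_Integration.integral_norm_bound_integral)
          (use B that matrix_conv_integrable[OF assms] integrable_box in auto)
    also have "\<dots> \<le> B * max 0 T"
      using B that by (cases "0 \<le> t") (auto intro: mult_left_mono)
    finally show ?thesis .
  qed
  then show "\<exists>B\<ge>0. \<forall>t\<le>T. norm (matrix_conv f g t) \<le> B"
    using B by (intro exI[of _ "B * max 0 T"]) auto
qed

lemma lborel_shift:
  fixes f :: "real \<Rightarrow> 'a::euclidean_space"
  shows "(\<integral>s. f (s + c) \<partial>lborel) = (\<integral>s. f s \<partial>lborel)"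
  using lborel_integral_real_affine[of 1 f c] by (simp add: add.commute)

lemma matrix_conv_assoc:
  assumes "causal f" "causal g" "causal k"
  shows "matrix_conv (matrix_conv f g) k = matrix_conv f (matrix_conv g k)"
proof
  fix t
  note [measurable] = assms[THEN causal_measurable]
  obtain A B C where bd: "A \<ge> 0" "\<forall>s\<le>t. norm (f s) \<le> A" "B \<ge> 0" "\<forall>s\<le>t. norm (g s) \<le> B"
      "C \<ge> 0" "\<forall>s\<le>t. norm (k s) \<le> C"
    using assms[THEN causal_bound, of t] by blast
  have bound: "norm (f (t - r) ** g (r - s) ** k s)
      \<le> (A * B * indicator {0..t} r) * (C * indicator {0..t} s)" for r s
  proof (cases "0 \<le> s \<and> s \<le> r \<and> r \<le> t")
    case True
    then have "norm (f (t - r)) * norm (g (r - s)) * norm (k s) \<le> A * B * C"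
      using bd by (intro mult_mono) auto
    then show ?thesis
      using True by (auto intro: order_trans[OF norm_mult3_le])
  next
    case False
    then have "f (t - r) = 0 \<or> g (r - s) = 0 \<or> k s = 0"
      using assms[THEN causal_neg] by (auto simp: not_le)
    then show ?thesis using bd by (auto simp: mult_nonneg_nonneg)
  qed
  have "matrix_conv (matrix_conv f g) k t = (\<integral>s. (\<integral>r. f (t - s - r) ** g r ** k s \<partial>lborel) \<partial>lborel)"
    by (simp add: matrix_conv_def integral_bounded_linear[OF mm.bounded_linear_left
        matrix_conv_integrable[OF assms(1,2)]])
  also have "\<dots> = (\<integral>s. (\<integral>r. f (t - r) ** g (r - s) ** k s \<partial>lborel) \<partial>lborel)"
  proof (rule Bochner_Integration.integral_cong[OF refl])
    fix s
    show "(\<integral>r. f (t - s - r) ** g r ** k s \<partial>lborel) = (\<integral>r. f (t - r) ** g (r - s) ** k s \<partial>lborel)"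
      by (subst lborel_shift[symmetric, of _ "- s"]) simp
  qed
  also have "\<dots> = (\<integral>r. (\<integral>s. f (t - r) ** g (r - s) ** k s \<partial>lborel) \<partial>lborel)"
    by (rule integrable_product_dominated(2)[OF _ _ _ integrable_box[of "A * B" 0 t]
          integrable_box[of C 0 t] bound, symmetric])
       (auto intro: lborel.sigma_finite_measure_axioms)
  also have "\<dots> = matrix_conv f (matrix_conv g k) t"
    by (simp add: matrix_conv_def matrix_mul_assoc[symmetric]
        integral_bounded_linear[OF mm.bounded_linear_right matrix_conv_integrable[OF assms(2,3)]])
  finally show "matrix_conv (matrix_conv f g) k t = matrix_conv f (matrix_conv g k) t" .
qed

lemma matrix_conv_add_left:
  "causal f \<Longrightarrow> causal g \<Longrightarrow> causal k \<Longrightarrow> matrix_conv (\<lambda>t. f t + g t) k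
      = (\<lambda>t. matrix_conv f k t + matrix_conv g k t)"
  unfolding matrix_conv_def by (rule ext) (simp add: mm.add_left matrix_conv_integrable)

lemma matrix_conv_diff_right:
  "causal f \<Longrightarrow> causal g \<Longrightarrow> causal k \<Longrightarrow> matrix_conv k (\<lambda>t. f t - g t)
      = (\<lambda>t. matrix_conv k f t - matrix_conv k g t)"
  unfolding matrix_conv_def by (rule ext) (simp add: mm.diff_right matrix_conv_integrable)

definition one_step :: "real \<Rightarrow> real^'n^'n" where
  "one_step t = (if t < 0 then 0 else mat 1)"

lemma causal_one_step: "causal (one_step :: real \<Rightarrow> real^'n^'n)"
  unfolding causal_def
proof (intro conjI allI)
  show "(one_step :: real \<Rightarrow> real^'n^'n) \<in> borel_measurable borel"
    unfolding one_step_def by measurable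
  show "\<exists>B\<ge>0. \<forall>t\<le>T. norm (one_step t :: real^'n^'n) \<le> B" for T
    by (intro exI[of _ "norm (mat 1 :: real^'n^'n)"]) (auto simp: one_step_def)
qed (simp add: one_step_def)

lemma causal_set_integrable:
  fixes f :: "real \<Rightarrow> 'a::euclidean_space"
  assumes "causal f"
  shows "set_integrable lborel {a..t} f"
proof -
  obtain B where "B \<ge> 0" "\<forall>u\<le>t. norm (f u) \<le> B"
    using causal_bound[OF assms] by blast
  then show ?thesis
    unfolding set_integrable_def
    by (intro integrable_dominated[OF integrable_box[of B a t]])
       (use causal_measurable[OF assms] in \<open>auto split: split_indicator\<close>)
qed

lemma matrix_conv_one_step:
  assumes "causal f"
  shows "matrix_conv one_step f t = integral {0..t} f"
proof -
  have "matrix_conv one_step f t = (LINT s:{0..t}|lborel. f s)"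
    unfolding matrix_conv_def set_lebesgue_integral_def
    by (rule Bochner_Integration.integral_cong)
       (auto simp: one_step_def indicator_def causal_neg[OF assms])
  also have "\<dots> = integral {0..t} f"
    by (rule set_borel_integral_eq_integral(2)[OF causal_set_integrable[OF assms]])
  finally show ?thesis .
qed

text \<open>
  The step is a multiple of the identity matrix, hence commutes with all matrices.
\<close>

lemma matrix_conv_one_step_commute: "matrix_conv f one_step = matrix_conv one_step f"
proof
  fix t
  have "matrix_conv f one_step t = (\<integral>s. one_step s ** f (t - s) \<partial>lborel)"
    unfolding matrix_conv_def by (rule Bochner_Integration.integral_cong) (auto simp: one_step_def)
  also have "\<dots> = matrix_conv one_step f t"
    unfolding matrix_conv_def
    using lborel_integral_real_affine[of "-1" "\<lambda>s. one_step s ** f (t - s)" t] by simp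
  finally show "matrix_conv f one_step t = matrix_conv one_step f t" .
qed

text \<open>
  Gronwall's inequality: on \<open>[0, t]\<close> the equation gives \<open>norm (P u) \<le> C \<Phi>(u)\<close> for the primitive
  \<open>\<Phi>\<close> of \<open>norm (P s)\<close>, so that \<open>exp (- C u) \<Phi>(u)\<close> is nonincreasing and starts at \<open>0\<close>.
\<close>

lemma Volterra_unique:
  fixes P k :: "real \<Rightarrow> real^'n^'n"
  assumes P: "causal P" "continuous_on {0..} P" and k: "causal k"
    and eq: "\<And>t. P t = - matrix_conv k P t"
  shows "P t = 0"
proof (cases "t < 0")
  case True
  then show ?thesis using causal_neg[OF P(1)] by simp
next
  case False
  obtain C where C: "C \<ge> 0" "\<forall>s\<le>t. norm (k s) \<le> C"
    using causal_bound[OF k] by blast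
  define \<Phi> where "\<Phi> u = integral {0..u} (\<lambda>s. norm (P s))" for u
  have cont: "continuous_on {0..t} (\<lambda>s. norm (P s))"
    by (intro continuous_intros continuous_on_subset[OF P(2)]) auto
  have nP: "causal (\<lambda>s. norm (P s))"
    using P(1) by (auto simp: causal_def)
  have le: "norm (P u) \<le> C * \<Phi> u" if u: "u \<in> {0..t}" for u
  proof -
    have "norm (P u) \<le> (\<integral>s. C * (indicator {0..u} s *\<^sub>R norm (P s)) \<partial>lborel)"
      unfolding eq[of u] norm_minus_cancel matrix_conv_def
    proof (rule Bochner_Integration.integral_norm_bound_integral)
      show "integrable lborel (\<lambda>s. C * (indicator {0..u} s *\<^sub>R norm (P s)))"
        using causal_set_integrable[OF nP, of 0 u]
        unfolding set_integrable_def by (rule integrable_mult_right)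
      fix s
      show "norm (k (u - s) ** P s) \<le> C * (indicator {0..u} s *\<^sub>R norm (P s))"
      proof (cases "0 \<le> s \<and> s \<le> u")
        case True
        then show ?thesis
          using C u by (auto intro!: order_trans[OF norm_matrix_mult_le] mult_right_mono)
      next
        case False
        then have "k (u - s) = 0 \<or> P s = 0"
          using causal_neg[OF k] causal_neg[OF P(1)] by auto
        then show ?thesis using C by auto
      qed
    qed (rule matrix_conv_integrable[OF k P(1)])
    also have "\<dots> = C * \<Phi> u"
      using set_borel_integral_eq_integral(2)[OF causal_set_integrable[OF nP, of 0 u]]
      by (simp add: \<Phi>_def set_lebesgue_integral_def)
    finally show ?thesis .
  qed
  have der: "(\<Phi> has_vector_derivative norm (P u)) (at u within {0..t})" if "u \<in> {0..t}" for u
    unfolding \<Phi>_def by (rule integral_has_vector_derivative[OF cont that])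
  have "exp (- C * t) * \<Phi> t \<le> exp (- C * 0) * \<Phi> 0"
  proof (rule DERIV_nonpos_imp_decreasing_open[of 0 t])
    show "continuous_on {0..t} (\<lambda>u. exp (- C * u) * \<Phi> u)"
      using der by (intro continuous_intros continuous_on_vector_derivative) auto
    fix u assume u: "0 < u" "u < t"
    then have "(\<Phi> has_real_derivative norm (P u)) (at u)"
      using der[of u] by (simp add: has_real_derivative_iff_has_vector_derivative at_within_Icc_at)
    then have "((\<lambda>u. exp (- C * u) * \<Phi> u) has_real_derivative exp (- C * u) * (norm
        (P u) - C * \<Phi> u)) (at u)"
      by (auto intro!: derivative_eq_intros simp: algebra_simps)
    then show "\<exists>y. ((\<lambda>u. exp (- C * u) * \<Phi> u) has_real_derivative y) (at u) \<and> y \<le> 0"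
      using le[of u] u by (intro exI conjI) (auto simp: mult_nonneg_nonpos)
  qed (use False in auto)
  then have "\<Phi> t \<le> 0"
    by (simp add: \<Phi>_def mult_le_0_iff)
  then have "C * \<Phi> t \<le> 0"
    by (rule mult_nonneg_nonpos[OF C(1)])
  moreover have "norm (P t) \<le> C * \<Phi> t"
    using le False by simp
  ultimately have "norm (P t) \<le> 0" by linarith
  then show ?thesis by simp
qed

section \<open>The right and left delay operators\<close>

locale delay_kernel =
  fixes h :: real and A0 A1 :: "real^'n^'n" and G :: "real \<Rightarrow> real^'n^'n"
  assumes h_pos: "h > 0" and G_int: "integrable (leb_on {-h..0}) G"
begin

lemma G_meas [measurable]: "G \<in> borel_measurable (leb_on {-h..0})"
  using G_int by auto

lemma sigma_finite_delay: "sigma_finite_measure (leb_on {-h..0})"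
  by (rule sigma_finite_leb_on) auto

definition right_op :: "(real \<Rightarrow> real^'n^'n) \<Rightarrow> real \<Rightarrow> real^'n^'n" where
  "right_op F t = F t ** A0 + F (t - h) ** A1 + (\<integral>\<theta>. F (t + \<theta>) ** G \<theta> \<partial>leb_on {-h..0})"

definition left_op :: "(real \<Rightarrow> real^'n^'n) \<Rightarrow> real \<Rightarrow> real^'n^'n" where
  "left_op F t = A0 ** F t + A1 ** F (t - h) + (\<integral>\<theta>. G \<theta> ** F (t + \<theta>) \<partial>leb_on {-h..0})"

lemma right_integrable:
  assumes "causal F"
  shows "integrable (leb_on {-h..0}) (\<lambda>\<theta>. F (t + \<theta>) ** G \<theta>)"
proof -
  note [measurable] = causal_measurable[OF assms]
  obtain B where B: "B \<ge> 0" "\<forall>s\<le>t. norm (F s) \<le> B"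
    using causal_bound[OF assms] by blast
  show ?thesis
    by (rule integrable_dominated[of _ "\<lambda>\<theta>. B * norm (G \<theta>)"])
       (use B G_int in \<open>auto simp: space_restrict_space intro!: order_trans[OF
           norm_matrix_mult_le] mult_right_mono\<close>)
qed

lemma left_integrable:
  assumes "causal F"
  shows "integrable (leb_on {-h..0}) (\<lambda>\<theta>. G \<theta> ** F (t + \<theta>))"
proof -
  note [measurable] = causal_measurable[OF assms]
  obtain B where B: "B \<ge> 0" "\<forall>s\<le>t. norm (F s) \<le> B"
    using causal_bound[OF assms] by blast
  show ?thesis
    by (rule integrable_dominated[of _ "\<lambda>\<theta>. norm (G \<theta>) * B"])
       (use B G_int in \<open>auto simp: space_restrict_space intro!: order_trans[OF
           norm_matrix_mult_le] mult_left_mono\<close>)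
qed

lemma causal_right_op:
  assumes "causal F"
  shows "causal (right_op F)"
  unfolding causal_def
proof (intro conjI allI impI)
  interpret sigma_finite_measure "leb_on {-h..0}" by (rule sigma_finite_delay)
  note [measurable] = causal_measurable[OF assms]
  show "right_op F \<in> borel_measurable borel"
    unfolding right_op_def by measurable
  show "right_op F t = 0" if "t < 0" for t
  proof -
    have "(\<integral>\<theta>. F (t + \<theta>) ** G \<theta> \<partial>leb_on {-h..0}) = (\<integral>\<theta>. 0 \<partial>leb_on {-h..0})"
      by (rule Bochner_Integration.integral_cong)
         (use that in \<open>auto simp: space_restrict_space causal_neg[OF assms]\<close>)
    then show ?thesis
      using that h_pos by (simp add: right_op_def causal_neg[OF assms])
  qed
  fix T :: real
  obtain B where B: "B \<ge> 0" "\<forall>s\<le>T. norm (F s) \<le> B"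
    using causal_bound[OF assms] by blast
  define C where "C = (\<integral>\<theta>. B * norm (G \<theta>) \<partial>leb_on {-h..0})"
  have "norm (right_op F t) \<le> B * norm A0 + B * norm A1 + C" if t: "t \<le> T" for t
    unfolding right_op_def C_def
  proof (intro norm_triangle_mono)
    show "norm (F t ** A0) \<le> B * norm A0" "norm (F (t - h) ** A1) \<le> B * norm A1"
      using B t h_pos by (auto intro!: order_trans[OF norm_matrix_mult_le] mult_right_mono)
    show "norm (\<integral>\<theta>. F (t + \<theta>) ** G \<theta> \<partial>leb_on {-h..0}) \<le> (\<integral>\<theta>. B * norm (G \<theta>) \<partial>leb_on {-h..0})"
      by (rule Bochner_Integration.integral_norm_bound_integral[OF right_integrable[OF assms]])
         (use B G_int t in \<open>auto simp: space_restrict_space intro!: order_trans[OF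
             norm_matrix_mult_le] mult_right_mono\<close>)
  qed
  moreover have "C \<ge> 0"
    unfolding C_def using B by (intro integral_nonneg_AE) auto
  ultimately show "\<exists>B\<ge>0. \<forall>t\<le>T. norm (right_op F t) \<le> B"
    using B by (intro exI[of _ "B * norm A0 + B * norm A1 + C"]) auto
qed

lemma causal_left_op:
  assumes "causal F"
  shows "causal (left_op F)"
  unfolding causal_def
proof (intro conjI allI impI)
  interpret sigma_finite_measure "leb_on {-h..0}" by (rule sigma_finite_delay)
  note [measurable] = causal_measurable[OF assms]
  show "left_op F \<in> borel_measurable borel"
    unfolding left_op_def by measurable
  show "left_op F t = 0" if "t < 0" for t
  proof -
    have "(\<integral>\<theta>. G \<theta> ** F (t + \<theta>) \<partial>leb_on {-h..0}) = (\<integral>\<theta>. 0 \<partial>leb_on {-h..0})"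
      by (rule Bochner_Integration.integral_cong)
         (use that in \<open>auto simp: space_restrict_space causal_neg[OF assms]\<close>)
    then show ?thesis
      using that h_pos by (simp add: left_op_def causal_neg[OF assms])
  qed
  fix T :: real
  obtain B where B: "B \<ge> 0" "\<forall>s\<le>T. norm (F s) \<le> B"
    using causal_bound[OF assms] by blast
  define C where "C = (\<integral>\<theta>. norm (G \<theta>) * B \<partial>leb_on {-h..0})"
  have "norm (left_op F t) \<le> norm A0 * B + norm A1 * B + C" if t: "t \<le> T" for t
    unfolding left_op_def C_def
  proof (intro norm_triangle_mono)
    show "norm (A0 ** F t) \<le> norm A0 * B" "norm (A1 ** F (t - h)) \<le> norm A1 * B"
      using B t h_pos by (auto intro!: order_trans[OF norm_matrix_mult_le] mult_left_mono)
    show "norm (\<integral>\<theta>. G \<theta> ** F (t + \<theta>) \<partial>leb_on {-h..0}) \<le> (\<integral>\<theta>. norm (G \<theta>) * B \<partial>leb_on {-h..0})"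
      by (rule Bochner_Integration.integral_norm_bound_integral[OF left_integrable[OF assms]])
         (use B G_int t in \<open>auto simp: space_restrict_space intro!: order_trans[OF
             norm_matrix_mult_le] mult_left_mono\<close>)
  qed
  moreover have "C \<ge> 0"
    unfolding C_def using B by (intro integral_nonneg_AE) auto
  ultimately show "\<exists>B\<ge>0. \<forall>t\<le>T. norm (left_op F t) \<le> B"
    using B by (intro exI[of _ "norm A0 * B + norm A1 * B + C"]) auto
qed

text \<open>
  This exchange is why the right and the left equation have the same fundamental matrix. Pointwise
  in \<open>\<theta>\<close> it is the translation of the integration variable by \<open>\<theta>\<close>, which moves the delay from one
  factor to the other; the matrix coefficient stays between the two factors.
\<close>

lemma matrix_conv_right_left:
  assumes "causal E" "causal F"
  shows "matrix_conv (right_op E) F = matrix_conv E (left_op F)"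
proof
  fix t
  note [measurable] = assms[THEN causal_measurable]
  obtain B C where bd: "B \<ge> 0" "\<forall>s\<le>t. norm (E s) \<le> B" "C \<ge> 0" "\<forall>s\<le>t. norm (F s) \<le> C"
    using assms[THEN causal_bound, of t] by blast
  let ?N = "leb_on {-h..0}"
  have sfl: "sigma_finite_measure (lborel :: real measure)"
    by (rule lborel.sigma_finite_measure_axioms)
  have G': "integrable ?N (\<lambda>\<theta>. norm (G \<theta>))"
    using G_int by simp
  have bound1: "norm (E (t - s + \<theta>) ** G \<theta> ** F s) \<le> (B * C * indicator {0..t} s) * norm (G \<theta>)"
    if "\<theta> \<in> space ?N" for s \<theta>
  proof (cases "0 \<le> s \<and> s \<le> t")
    case True
    then have "norm (E (t - s + \<theta>)) * norm (G \<theta>) * norm (F s) \<le> B * norm (G \<theta>) * C"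
      using bd that by (intro mult_mono) (auto simp: space_restrict_space)
    then show ?thesis
      using True by (auto intro: order_trans[OF norm_mult3_le] simp: ac_simps)
  next
    case False
    then have "E (t - s + \<theta>) = 0 \<or> F s = 0"
      using assms[THEN causal_neg] that by (auto simp: not_le space_restrict_space)
    then show ?thesis using bd by auto
  qed
  have bound2: "norm (E (t - s) ** G \<theta> ** F (s + \<theta>)) \<le> (B * C * indicator {0..t} s) * norm (G \<theta>)"
    if "\<theta> \<in> space ?N" for s \<theta>
  proof (cases "0 \<le> s \<and> s \<le> t")
    case True
    then have "norm (E (t - s)) * norm (G \<theta>) * norm (F (s + \<theta>)) \<le> B * norm (G \<theta>) * C"
      using bd that by (intro mult_mono) (auto simp: space_restrict_space)
    then show ?thesis
      using True by (auto intro: order_trans[OF norm_mult3_le] simp: ac_simps)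
  next
    case False
    then have "E (t - s) = 0 \<or> F (s + \<theta>) = 0"
      using assms[THEN causal_neg] that by (auto simp: not_le space_restrict_space)
    then show ?thesis using bd by auto
  qed
  have m1: "(\<lambda>(s, \<theta>). E (t - s + \<theta>) ** G \<theta> ** F s) \<in> borel_measurable (lborel \<Otimes>\<^sub>M ?N)"
    by measurable
  have m2: "(\<lambda>(s, \<theta>). E (t - s) ** G \<theta> ** F (s + \<theta>)) \<in> borel_measurable (lborel \<Otimes>\<^sub>M ?N)"
    by measurable
  note f1 = integrable_product_dominated[OF sfl sigma_finite_delay m1 integrable_box G' bound1]
  note f2 = integrable_product_dominated[OF sfl sigma_finite_delay m2 integrable_box G' bound2]
  have cE: "causal (\<lambda>t. E (t - h) ** A1)" and cE0: "causal (\<lambda>t. E t ** A0)"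
    and cF: "causal (\<lambda>t. A1 ** F (t - h))" and cF0: "causal (\<lambda>t. A0 ** F t)"
    using causal_delay_mult[OF assms(1), of h A1] causal_delay_mult[OF assms(1), of 0 A0]
      causal_delay_mult[OF assms(2), of h A1] causal_delay_mult[OF assms(2), of 0 A0] h_pos
    by simp_all
  have i1: "integrable lborel (\<lambda>s. E (t - s) ** A0 ** F s)"
    using matrix_conv_integrable[OF cE0 assms(2)] .
  have i2: "integrable lborel (\<lambda>s. E (t - s - h) ** A1 ** F s)"
    using matrix_conv_integrable[OF cE assms(2)] .
  have i4: "integrable lborel (\<lambda>s. E (t - s) ** A1 ** F (s - h))"
    using matrix_conv_integrable[OF assms(1) cF] by (simp add: matrix_mul_assoc)
  have "matrix_conv (right_op E) F t = (\<integral>s. E (t - s) ** A0 ** F s + E (t - s - h) ** A1 ** F s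
      + (\<integral>\<theta>. E (t - s + \<theta>) ** G \<theta> ** F s \<partial>?N) \<partial>lborel)"
    by (simp add: matrix_conv_def right_op_def mm.add_left
        integral_bounded_linear[OF mm.bounded_linear_left right_integrable[OF assms(1)]])
  also have "\<dots> = (\<integral>s. E (t - s) ** A0 ** F s \<partial>lborel) + (\<integral>s. E (t - s - h) ** A1 ** F s \<partial>lborel)
      + (\<integral>s. \<integral>\<theta>. E (t - s + \<theta>) ** G \<theta> ** F s \<partial>?N \<partial>lborel)"
    using i1 i2 f1(3) by simp
  also have "(\<integral>s. E (t - s - h) ** A1 ** F s \<partial>lborel) = (\<integral>s. E (t - s) ** A1 ** F (s - h) \<partial>lborel)"
    by (subst lborel_shift[symmetric, of _ "- h"]) simp
  also have "(\<integral>s. \<integral>\<theta>. E (t - s + \<theta>) ** G \<theta> ** F s \<partial>?N \<partial>lborel)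
      = (\<integral>\<theta>. \<integral>s. E (t - s + \<theta>) ** G \<theta> ** F s \<partial>lborel \<partial>?N)"
    by (rule f1(2))
  also have "\<dots> = (\<integral>\<theta>. \<integral>s. E (t - s) ** G \<theta> ** F (s + \<theta>) \<partial>lborel \<partial>?N)"
  proof (rule Bochner_Integration.integral_cong[OF refl])
    fix \<theta>
    show "(\<integral>s. E (t - s + \<theta>) ** G \<theta> ** F s \<partial>lborel) = (\<integral>s. E (t - s) ** G \<theta> ** F (s + \<theta>) \<partial>lborel)"
      by (subst lborel_shift[symmetric, of _ \<theta>]) simp
  qed
  also have "\<dots> = (\<integral>s. \<integral>\<theta>. E (t - s) ** G \<theta> ** F (s + \<theta>) \<partial>?N \<partial>lborel)"
    by (rule f2(2)[symmetric])
  also have "(\<integral>s. E (t - s) ** A0 ** F s \<partial>lborel) + (\<integral>s. E (t - s) ** A1 ** F (s - h) \<partial>lborel) + \<dots>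
     = (\<integral>s. E (t - s) ** A0 ** F s + E (t - s) ** A1 ** F (s - h)
      + (\<integral>\<theta>. E (t - s) ** G \<theta> ** F (s + \<theta>) \<partial>?N) \<partial>lborel)"
    using i1 i4 f2(3) by simp
  also have "\<dots> = matrix_conv E (left_op F) t"
    by (simp add: matrix_conv_def left_op_def mm.add_right matrix_mul_assoc[symmetric]
        integral_bounded_linear[OF mm.bounded_linear_right left_integrable[OF assms(2)]])
  finally show "matrix_conv (right_op E) F t = matrix_conv E (left_op F) t" .
qed

end

section \<open>One-sided derivatives and continuity\<close>

text \<open>
  A right derivative suffices because of a continuity argument: for \<open>e > 0\<close>, the largest \<open>c\<close> up to
  which \<open>f\<close> moves at speed at most \<open>e\<close> is attained by continuity, and if \<open>c < b\<close> the right
  derivative at \<open>c\<close> would extend the estimate beyond \<open>c\<close>.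
\<close>

lemma constant_of_right_derivative_zero:
  fixes f :: "real \<Rightarrow> 'a::real_normed_vector"
  assumes "a \<le> b" and cont: "continuous_on {a..b} f"
    and der: "\<And>t. a \<le> t \<Longrightarrow> t < b \<Longrightarrow> (f has_vector_derivative 0) (at_right t)"
  shows "f b = f a"
proof -
  have bound: "norm (f b - f a) \<le> e * (b - a)" if "e > 0" for e
  proof -
    define T where "T = {t \<in> {a..b}. norm (f t - f a) - e * (t - a) \<le> 0}"
    define S where "S = {t \<in> {a..b}. {a..t} \<subseteq> T}"
    define c where "c = Sup S"
    have closed: "closed T"
    proof -
      have "T = {a..b} \<inter> (\<lambda>t. norm (f t - f a) - e * (t - a)) -` {..0}"
        by (auto simp: T_def)
      also have "closed \<dots>"
        by (intro continuous_closed_preimage continuous_intros cont)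
      finally show ?thesis .
    qed
    have aS: "a \<in> S"
      using \<open>a \<le> b\<close> by (auto simp: S_def T_def)
    have bdd: "bdd_above S"
      by (auto simp: S_def intro: bdd_aboveI[of _ b])
    have "t \<le> b" if "t \<in> S" for t
      using that by (simp add: S_def)
    then have "Sup S \<le> b"
      using aS by (intro cSup_least) auto
    moreover have "a \<le> Sup S"
      by (rule cSup_upper[OF aS bdd])
    ultimately have c: "a \<le> c" "c \<le> b"
      by (simp_all add: c_def)
    have "{a..<c} \<subseteq> T"
    proof
      fix s assume "s \<in> {a..<c}"
      then obtain t where "t \<in> S" "s < t"
        unfolding c_def using less_cSup_iff[of S s] aS bdd by auto
      with \<open>s \<in> _\<close> show "s \<in> T" by (auto simp: S_def)
    qed
    have cT: "{a..c} \<subseteq> T"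
    proof (cases "a < c")
      case True
      then show ?thesis
        using closure_minimal[OF \<open>{a..<c} \<subseteq> T\<close> closed] by simp
    next
      case False
      then show ?thesis using c aS by (auto simp: S_def)
    qed
    have "c = b"
    proof (rule ccontr)
      assume "c \<noteq> b"
      then have "c < b" using c by simp
      have "((\<lambda>y. norm (f y - f c) / norm (y - c)) \<longlongrightarrow> 0) (at_right c)"
        using der[OF c(1) \<open>c < b\<close>]
        unfolding has_vector_derivative_def has_derivative_iff_norm by simp
      then have "eventually (\<lambda>y. norm (f y - f c) / norm (y - c) < e) (at_right c)"
        using \<open>e > 0\<close> by (rule order_tendstoD)
      then obtain d where d: "c < d" "\<And>y. c < y \<Longrightarrow> y < d \<Longrightarrow> norm (f y - f c) / norm (y - c) < e"
        unfolding eventually_at_right_field by auto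
      obtain m where m: "c < m" "m < d" "m < b"
        using \<open>c < b\<close> d(1) dense[of c "min d b"] by auto
      have "s \<in> T" if s: "s \<in> {a..m}" for s
      proof (cases "s \<le> c")
        case True
        then show ?thesis using s cT by auto
      next
        case False
        then have "norm (f s - f c) \<le> e * (s - c)"
          using d(2)[of s] s m by (auto simp: field_simps)
        moreover have "norm (f c - f a) \<le> e * (c - a)"
          using cT c by (auto simp: T_def)
        moreover have "norm (f s - f a) \<le> norm (f s - f c) + norm (f c - f a)"
          using norm_triangle_ineq[of "f s - f c" "f c - f a"] by simp
        ultimately show ?thesis
          using s m c by (auto simp: T_def algebra_simps)
      qed
      then have "m \<in> S" using m c by (auto simp: S_def)
      then show False
        using cSup_upper[OF _ bdd] m(1) unfolding c_def by force
    qed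
    then show ?thesis
      using cT c by (auto simp: T_def)
  qed
  have "norm (f b - f a) \<le> 0"
  proof (rule field_le_epsilon)
    fix e :: real assume "e > 0"
    then show "norm (f b - f a) \<le> 0 + e"
      using bound[of "e / (b - a)"] bound[of 1] \<open>a \<le> b\<close> by (cases "a = b") auto
  qed
  then show ?thesis by simp
qed

lemma causal_integrable_on:
  fixes f :: "real \<Rightarrow> 'a::euclidean_space"
  shows "causal f \<Longrightarrow> f integrable_on {a..b}"
  by (rule set_borel_integral_eq_integral(1)[OF causal_set_integrable])

text \<open>
  The base point \<open>a\<close> is separate from \<open>0\<close> since the integrands below are right continuous but jump
  at \<open>0\<close> and at \<open>h\<close>: starting the interval at the jump keeps one-sided continuity sufficient.
\<close>

lemma integral_has_derivative_within:
  fixes f :: "real \<Rightarrow> 'a::euclidean_space"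
  assumes f: "causal f" and "0 \<le> a" "a \<le> x" "x < b"
    and cont: "continuous (at x within {a..b}) f"
  shows "((\<lambda>u. integral {0..u} f) has_vector_derivative f x) (at x within {a..b})"
proof -
  have "((\<lambda>u. integral {0..a} f + integral {a..u} f) has_vector_derivative 0 + f x)
      (at x within {a..b})"
    using integral_has_vector_derivative_continuous_at[of f a b x "{}"]
      causal_integrable_on[OF f] assms
    by (intro has_vector_derivative_add has_vector_derivative_const) auto
  then have der: "((\<lambda>u. integral {0..a} f + integral {a..u} f) has_vector_derivative f x)
      (at x within {a..b})"
    by simp
  have eq: "integral {0..u} f = integral {0..a} f + integral {a..u} f" if "u \<in> {a..b}" for u
    using that assms by (intro Henstock_Kurzweil_Integration.integral_combine[symmetric]
        causal_integrable_on[OF f]) auto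
  show ?thesis
    by (rule has_vector_derivative_transform[OF _ eq der]) (use assms(3,4) in simp_all)
qed

lemma integral_has_right_derivative:
  fixes f :: "real \<Rightarrow> 'a::euclidean_space"
  assumes "causal f" "0 \<le> x" "continuous (at_right x) f"
  shows "((\<lambda>u. integral {0..u} f) has_vector_derivative f x) (at_right x)"
  using integral_has_derivative_within[of f x x "x + 1"] assms
  by (simp add: at_within_Icc_at_right)

lemma at_within_atLeast_eq:
  "at t within {a..t + 1} = at t within {a..}" for a t :: real
  by (rule at_within_nhd[of t "{..<t + 1}"]) auto

lemma continuous_on_integral_from_0:
  fixes f :: "real \<Rightarrow> 'a::euclidean_space"
  assumes "causal f"
  shows "continuous_on {0..} (\<lambda>t. integral {0..t} f)"
  unfolding continuous_on_eq_continuous_within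
proof
  fix t :: real assume "t \<in> {0..}"
  moreover have "continuous_on {0..t + 1} (\<lambda>t. integral {0..t} f)"
    by (intro indefinite_integral_continuous_1 causal_integrable_on assms)
  ultimately have "continuous (at t within {0..t + 1}) (\<lambda>t. integral {0..t} f)"
    by (simp add: continuous_on_eq_continuous_within)
  then show "continuous (at t within {0..}) (\<lambda>t. integral {0..t} f)"
    by (simp add: at_within_atLeast_eq)
qed

lemma causal_isCont:
  fixes F :: "real \<Rightarrow> 'a::real_normed_vector"
  assumes "causal F" "continuous_on {0..} F" "t \<noteq> 0"
  shows "isCont F t"
proof (cases "t < 0")
  case True
  have "continuous_on {..<0} F"
    by (rule continuous_on_eq[OF continuous_on_const[of _ 0]]) (simp add: causal_neg[OF assms(1)])
  then show ?thesis
    using True by (auto simp: continuous_on_eq_continuous_at)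
next
  case False
  then show ?thesis
    using assms(3) by (intro continuous_on_interior[OF assms(2)]) auto
qed

lemma causal_right_continuous:
  assumes "causal F" "continuous_on {0..} F"
  shows "continuous (at_right t) F"
proof (cases "t = 0")
  case True
  then have "continuous (at t within {0..}) F"
    using assms(2) by (simp add: continuous_on_eq_continuous_within)
  then show ?thesis
    by (rule continuous_within_subset) (use True in auto)
next
  case False
  show ?thesis
    using causal_isCont[OF assms False] by (rule continuous_at_imp_continuous_within)
qed

lemma right_continuous_shift:
  fixes F :: "real \<Rightarrow> 'a::topological_space"
  assumes "continuous (at_right (t - h)) F"
  shows "continuous (at_right t) (\<lambda>t. F (t - h))"
proof -
  have "continuous (at ((\<lambda>t. t - h) t) within (\<lambda>t. t - h) ` {t<..}) F"
    by (rule continuous_within_subset[OF assms]) auto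
  then show ?thesis
    using continuous_within_compose[of t "{t<..}" "\<lambda>t. t - h" F,
        OF continuous_diff[OF continuous_ident continuous_const]]
    by (simp add: o_def)
qed

context delay_kernel
begin

lemma AE_neq: "AE \<theta> in leb_on {-h..0}. t + \<theta> \<noteq> (0::real)"
proof -
  have "AE \<theta> in lebesgue. \<theta> \<noteq> - t"
    by (rule AE_completion[OF AE_lborel_singleton])
  then show ?thesis
    by (subst AE_restrict_space_iff) (auto elim!: eventually_mono)
qed

text \<open>
  The jump of \<open>F\<close> at \<open>0\<close> affects a single value of \<open>\<theta>\<close>, a null set, so that dominated convergence
  gives two-sided continuity everywhere.
\<close>

lemma isCont_distributed:
  assumes F: "causal F" "continuous_on {0..} F"
  shows "isCont (\<lambda>t. \<integral>\<theta>. F (t + \<theta>) ** G \<theta> \<partial>leb_on {-h..0}) t"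
    and "isCont (\<lambda>t. \<integral>\<theta>. G \<theta> ** F (t + \<theta>) \<partial>leb_on {-h..0}) t"
proof -
  note [measurable] = causal_measurable[OF F(1)]
  have main: "(\<lambda>n. \<integral>\<theta>. F (u n + \<theta>) ** G \<theta> \<partial>leb_on {-h..0}) \<longlonglongrightarrow> (\<integral>\<theta>. F (t + \<theta>) ** G \<theta> \<partial>leb_on {-h..0})"
    "(\<lambda>n. \<integral>\<theta>. G \<theta> ** F (u n + \<theta>) \<partial>leb_on {-h..0}) \<longlonglongrightarrow> (\<integral>\<theta>. G \<theta> ** F (t + \<theta>) \<partial>leb_on {-h..0})"
    if u: "u \<longlonglongrightarrow> t" for u
  proof -
    obtain T where T: "\<And>n. u n \<le> T"
      using convergent_imp_Bseq[OF convergentI[OF u]] unfolding Bseq_def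
      by (metis abs_le_D1 real_norm_def)
    obtain B where B: "B \<ge> 0" "\<forall>s\<le>T. norm (F s) \<le> B"
      using causal_bound[OF F(1)] by blast
    have lim: "AE \<theta> in leb_on {-h..0}. (\<lambda>n. F (u n + \<theta>)) \<longlonglongrightarrow> F (t + \<theta>)"
      using AE_neq[of t]
    proof eventually_elim
      case (elim \<theta>)
      show ?case
        by (rule isCont_tendsto_compose[OF causal_isCont[OF F elim]]) (intro tendsto_intros u)
    qed
    have Fb: "norm (F (u n + \<theta>)) \<le> B" if "\<theta> \<in> space (leb_on {-h..0})" for n \<theta>
      using B(2) T[of n] that by (auto simp: space_restrict_space)
    show "(\<lambda>n. \<integral>\<theta>. F (u n + \<theta>) ** G \<theta> \<partial>leb_on {-h..0}) \<longlonglongrightarrow> (\<integral>\<theta>. F (t + \<theta>) ** G \<theta> \<partial>leb_on {-h..0})"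
    proof (rule integral_dominated_convergence[where w = "\<lambda>\<theta>. B * norm (G \<theta>)"])
      show "AE \<theta> in leb_on {-h..0}. (\<lambda>n. F (u n + \<theta>) ** G \<theta>) \<longlonglongrightarrow> F (t + \<theta>) ** G \<theta>"
        using lim by eventually_elim (intro mm.tendsto tendsto_const)
      show "AE \<theta> in leb_on {-h..0}. norm (F (u n + \<theta>) ** G \<theta>) \<le> B * norm (G \<theta>)" for n
        using Fb by (auto intro!: AE_I2 order_trans[OF norm_matrix_mult_le] mult_right_mono)
    qed (use G_int in auto)
    show "(\<lambda>n. \<integral>\<theta>. G \<theta> ** F (u n + \<theta>) \<partial>leb_on {-h..0}) \<longlonglongrightarrow> (\<integral>\<theta>. G \<theta> ** F (t + \<theta>) \<partial>leb_on {-h..0})"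
    proof (rule integral_dominated_convergence[where w = "\<lambda>\<theta>. norm (G \<theta>) * B"])
      show "AE \<theta> in leb_on {-h..0}. (\<lambda>n. G \<theta> ** F (u n + \<theta>)) \<longlonglongrightarrow> G \<theta> ** F (t + \<theta>)"
        using lim by eventually_elim (intro mm.tendsto tendsto_const)
      show "AE \<theta> in leb_on {-h..0}. norm (G \<theta> ** F (u n + \<theta>)) \<le> norm (G \<theta>) * B" for n
        using Fb by (auto intro!: AE_I2 order_trans[OF norm_matrix_mult_le] mult_left_mono)
    qed (use G_int in auto)
  qed
  show "isCont (\<lambda>t. \<integral>\<theta>. F (t + \<theta>) ** G \<theta> \<partial>leb_on {-h..0}) t"
    "isCont (\<lambda>t. \<integral>\<theta>. G \<theta> ** F (t + \<theta>) \<partial>leb_on {-h..0}) t"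
    unfolding continuous_at_sequentially using main by (auto simp: o_def)
qed

lemma right_continuous_ops:
  assumes F: "causal F" "continuous_on {0..} F"
  shows "continuous (at_right t) (right_op F)" "continuous (at_right t) (left_op F)"
  unfolding right_op_def left_op_def
  by (intro continuous_add mm.continuous continuous_const causal_right_continuous[OF F]
      right_continuous_shift isCont_distributed[OF F, THEN continuous_at_imp_continuous_within])+

lemma continuous_on_left_op:
  assumes F: "causal F" "continuous_on {0..} F"
  shows "continuous_on {h..} (left_op F)"
  unfolding left_op_def
proof (intro continuous_on_add mm.continuous_on continuous_on_const)
  show "continuous_on {h..} F"
    using h_pos by (auto intro: continuous_on_subset[OF F(2)])
  show "continuous_on {h..} (\<lambda>t. F (t - h))"
    by (rule continuous_on_compose2[OF F(2)]) (auto intro!: continuous_intros)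
  show "continuous_on {h..} (\<lambda>t. \<integral>\<theta>. G \<theta> ** F (t + \<theta>) \<partial>leb_on {-h..0})"
    by (intro continuous_at_imp_continuous_on ballI isCont_distributed[OF F])
qed

end

section \<open>The fundamental matrix solves the left equation and decays\<close>

lemma norm_le_sum_columns:
  fixes A :: "real^'n^'m"
  shows "norm A \<le> (\<Sum>j\<in>UNIV. norm (A *v axis j 1))"
proof -
  have "A *v axis j 1 = column j A" for j
    by (simp add: matrix_vector_mult_basis)
  moreover have "norm (transpose A) \<le> (\<Sum>j\<in>UNIV. norm (transpose A $ j))"
    unfolding norm_vec_def by (rule L2_set_le_sum) simp
  moreover have "transpose A $ j = column j A" for j
    by (simp add: transpose_def column_def)
  ultimately show ?thesis by simp
qed

locale fundamental_system = delay_kernel h A0 A1 G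
  for h :: real and A0 A1 :: "real^'n^'n" and G :: "real \<Rightarrow> real^'n^'n" +
  fixes K :: "real \<Rightarrow> real^'n^'n"
  assumes fundamental: "fundamental_matrix h A0 A1 G K"
begin

lemma K_neg: "t < 0 \<Longrightarrow> K t = 0"
  and K_0: "K 0 = mat 1"
  and K_cont: "continuous_on {0..} K"
  using fundamental by (auto simp: fundamental_matrix_def)

lemma K_right_derivative:
  "t \<ge> 0 \<Longrightarrow> (K has_vector_derivative right_op K t) (at_right t)"
  using fundamental by (simp add: fundamental_matrix_def right_op_def set_lint_leb_on)

lemma causal_K: "causal K"
  unfolding causal_def
proof (intro conjI allI impI)
  have "(\<lambda>t. indicator {0..} t *\<^sub>R K t) \<in> borel_measurable borel"
    by (rule borel_measurable_continuous_on_indicator[OF _ K_cont]) simp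
  also have "(\<lambda>t. indicator {0..} t *\<^sub>R K t) = K"
    by (auto simp: K_neg indicator_def)
  finally show "K \<in> borel_measurable borel" .
  fix T :: real
  have "compact (K ` {0..T})"
    by (intro compact_continuous_image continuous_on_subset[OF K_cont]) auto
  then obtain B where B: "\<forall>x\<in>K ` {0..T}. norm x \<le> B"
    using bounded_iff compact_imp_bounded by blast
  have "norm (K t) \<le> \<bar>B\<bar>" if "t \<le> T" for t
    using B that by (cases "t < 0") (auto simp: K_neg intro: order_trans[OF _ abs_ge_self])
  then show "\<exists>B\<ge>0. \<forall>t\<le>T. norm (K t) \<le> B"
    by (intro exI[of _ "\<bar>B\<bar>"]) auto
qed (rule K_neg)

text \<open>
  The integrated form of the defining equation. Both sides have the same right derivative, since
  \<open>right_op K\<close> is right continuous.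
\<close>

lemma K_eq_right: "K = (\<lambda>t. one_step t + matrix_conv one_step (right_op K) t)"
proof
  fix t
  note cR = causal_right_op[OF causal_K]
  show "K t = one_step t + matrix_conv one_step (right_op K) t"
  proof (cases "t < 0")
    case True
    then show ?thesis
      using causal_neg[OF causal_matrix_conv[OF causal_one_step cR]]
          by (simp add: K_neg one_step_def)
  next
    case False
    let ?D = "\<lambda>u. K u - integral {0..u} (right_op K)"
    have "?D t = ?D 0"
    proof (rule constant_of_right_derivative_zero)
      show "continuous_on {0..t} ?D"
        by (intro continuous_intros continuous_on_subset[OF K_cont] indefinite_integral_continuous_1
            causal_integrable_on cR) auto
      fix u :: real assume "0 \<le> u"
      then show "(?D has_vector_derivative 0) (at_right u)"
        using has_vector_derivative_diff[OF K_right_derivative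
            integral_has_right_derivative[OF cR _ right_continuous_ops(1)[OF causal_K K_cont]]]
        by fastforce
    qed (use False in simp)
    then have "K t = mat 1 + integral {0..t} (right_op K)"
      by (simp add: K_0 algebra_simps)
    then show ?thesis
      using False by (simp add: matrix_conv_one_step[OF cR] one_step_def)
  qed
qed

text \<open>
  With \<open>H\<close> the defect of the claimed equation, associativity and the exchange
  \<open>matrix_conv_right_left\<close> give \<open>K * H = 0\<close>; then \<open>1 * H\<close> solves a homogeneous Volterra equation,
  vanishes, and so does its right derivative \<open>H\<close>.
\<close>

lemma K_eq_left: "K = (\<lambda>t. one_step t + matrix_conv one_step (left_op K) t)"
proof -
  note c1 = causal_one_step[where 'n = 'n]
  note cK = causal_K
  note cR = causal_right_op[OF causal_K]
  note cL = causal_left_op[OF causal_K]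
  note c1L = causal_matrix_conv[OF c1 cL]
  define H where "H t = K t - (one_step t + matrix_conv one_step (left_op K) t)" for t
  have cH: "causal H"
    unfolding H_def by (intro causal_diff causal_add cK c1 c1L)
  \<comment> \<open>K * K = 1 * K + 1 * (K * L) and K * (1 * L) = 1 * (K * L), hence K * H = 0.\<close>
  have "matrix_conv K K = matrix_conv (\<lambda>t. one_step t + matrix_conv one_step (right_op K) t) K"
    using K_eq_right by simp
  also have "\<dots> = (\<lambda>t. matrix_conv one_step K t + matrix_conv (matrix_conv one_step
      (right_op K)) K t)"
    by (rule matrix_conv_add_left[OF c1 causal_matrix_conv[OF c1 cR] cK])
  also have "matrix_conv (matrix_conv one_step (right_op K)) K
      = matrix_conv one_step (matrix_conv K (left_op K))"
    by (simp add: matrix_conv_assoc[OF c1 cR cK] matrix_conv_right_left[OF cK cK])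
  finally have KK: "matrix_conv K K = (\<lambda>t. matrix_conv one_step K t + matrix_conv one_step
      (matrix_conv K (left_op K)) t)" .
  have "matrix_conv K (matrix_conv one_step (left_op K))
      = matrix_conv (matrix_conv K one_step) (left_op K)"
    by (rule matrix_conv_assoc[OF cK c1 cL, symmetric])
  also have "\<dots> = matrix_conv one_step (matrix_conv K (left_op K))"
    by (simp add: matrix_conv_one_step_commute matrix_conv_assoc[OF c1 cK cL])
  finally have K1L: "matrix_conv K (matrix_conv one_step (left_op K))
      = matrix_conv one_step (matrix_conv K (left_op K))" .
  have "matrix_conv K H = (\<lambda>t. matrix_conv K (\<lambda>t. K t - one_step t) t - matrix_conv K
      (matrix_conv one_step (left_op K)) t)"
    unfolding H_def diff_diff_eq[symmetric]
    by (rule matrix_conv_diff_right[OF causal_diff[OF cK c1] c1L cK])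
  then have KH: "matrix_conv K H t = 0" for t
    by (simp add: matrix_conv_diff_right[OF cK c1 cK] KK K1L matrix_conv_one_step_commute)
  define P where "P = matrix_conv one_step H"
  have P_int: "P t = integral {0..t} H" for t
    by (simp add: P_def matrix_conv_one_step[OF cH])
  have "matrix_conv K H = (\<lambda>t. matrix_conv one_step H t + matrix_conv (matrix_conv one_step
      (right_op K)) H t)"
    by (subst K_eq_right) (rule matrix_conv_add_left[OF c1 causal_matrix_conv[OF c1 cR] cH])
  also have "matrix_conv (matrix_conv one_step (right_op K)) H = matrix_conv (right_op K) P"
    unfolding P_def by (simp add: matrix_conv_assoc[OF cR c1 cH, symmetric]
        matrix_conv_one_step_commute)
  finally have P_eq: "P t = - matrix_conv (right_op K) P t" for t
    using KH[of t] by (simp add: P_def eq_neg_iff_add_eq_0)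
  have "continuous_on {0..} P"
    using continuous_on_integral_from_0[OF cH] by (simp add: P_int[abs_def])
  then have P0: "P t = 0" for t
    using Volterra_unique[OF _ _ cR P_eq] causal_matrix_conv[OF c1 cH] by (simp add: P_def)
  have "H t = 0" for t
  proof (cases "t < 0")
    case True
    then show ?thesis by (rule causal_neg[OF cH])
  next
    case False
    have "continuous (at_right t) (\<lambda>u. integral {0..u} (left_op K))"
      by (rule has_vector_derivative_continuous,
          rule integral_has_right_derivative[OF cL _ right_continuous_ops(2)[OF causal_K K_cont]])
         (use False in simp)
    moreover have "continuous (at_right t) (one_step :: real \<Rightarrow> real^'n^'n)"
      by (rule causal_right_continuous[OF c1])
         (rule continuous_on_eq[OF continuous_on_const[of _ "mat 1"]], simp add: one_step_def)
    ultimately have "continuous (at_right t) H"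
      unfolding H_def matrix_conv_one_step[OF cL]
      by (intro continuous_diff continuous_add causal_right_continuous[OF causal_K K_cont])
    then have "((\<lambda>u. integral {0..u} H) has_vector_derivative H t) (at_right t)"
      using False by (intro integral_has_right_derivative[OF cH]) auto
    then have "((\<lambda>u. 0) has_vector_derivative H t) (at_right t)"
      by (simp add: P0 flip: P_int)
    then show ?thesis
      using vector_derivative_unique_within[OF trivial_limit_at_right_real _
          has_vector_derivative_const]
      by blast
  qed
  then show ?thesis
    by (auto simp: H_def fun_eq_iff)
qed

text \<open>
  The delay by \<open>h\<close> moves the jump of \<open>K\<close> out of sight: for \<open>t \<ge> - h\<close> the function only uses \<open>K\<close> on
  the nonnegative axis. The equation is needed for \<open>t + h \<ge> h\<close>, where \<open>left_op K\<close> is continuous on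
  \<open>[h, \<infinity>)\<close>; this gives the derivative within \<open>[0, \<infinity>)\<close> and not just a right derivative.
\<close>

lemma delay_solution_K: "delay_solution h A0 A1 G (\<lambda>t. K (t + h) *v v)"
  unfolding delay_solution_def
proof (intro conjI allI impI)
  note cL = causal_left_op[OF causal_K]
  have bv: "bounded_linear (\<lambda>M :: real^'n^'n. M *v v)"
    by (rule linear_conv_bounded_linear[THEN iffD1], rule linearI)
       (simp_all add: matrix_vector_mult_add_rdistrib scaleR_matrix_vector_assoc)
  show "continuous_on {-h..} (\<lambda>t. K (t + h) *v v)"
    by (intro bounded_linear.continuous_on[OF bv] continuous_on_compose2[OF K_cont])
        (auto intro!: continuous_intros)
  fix t :: real assume t: "t \<ge> 0"
  have "(K has_vector_derivative left_op K (t + h)) (at (t + h) within {h..t + h + 1})"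
  proof -
    have "((\<lambda>u. integral {0..u} (left_op K)) has_vector_derivative left_op K (t + h))
        (at (t + h) within {h..t + h + 1})"
    proof (rule integral_has_derivative_within[OF cL])
      have "continuous (at (t + h) within {h..}) (left_op K)"
        using t continuous_on_left_op[OF causal_K K_cont]
        by (simp add: continuous_on_eq_continuous_within)
      then show "continuous (at (t + h) within {h..t + h + 1}) (left_op K)"
        by (rule continuous_within_subset) auto
    qed (use t h_pos in auto)
    then have "((\<lambda>u. mat 1 + integral {0..u} (left_op K))
        has_vector_derivative 0 + left_op K (t + h)) (at (t + h) within {h..t + h + 1})"
      by (intro has_vector_derivative_add has_vector_derivative_const)
    then have der: "((\<lambda>u. mat 1 + integral {0..u} (left_op K))
        has_vector_derivative left_op K (t + h)) (at (t + h) within {h..t + h + 1})"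
      by simp
    have eq: "K u = mat 1 + integral {0..u} (left_op K)" if "u \<in> {h..t + h + 1}" for u
      using fun_cong[OF K_eq_left, of u] that h_pos by (simp add: matrix_conv_one_step[OF cL]
          one_step_def)
    show ?thesis
      by (rule has_vector_derivative_transform[OF _ eq der]) (use t in simp_all)
  qed
  then have "(K has_vector_derivative left_op K (t + h))
      (at (t + h) within (\<lambda>s. s + h) ` {0..t + 1})"
    by (simp add: add.commute add.left_commute)
  moreover have "((\<lambda>s. s + h) has_vector_derivative 1) (at t within {0..t + 1})"
    by (auto intro!: derivative_eq_intros)
  ultimately have "((\<lambda>s. K (s + h)) has_vector_derivative left_op K (t + h))
      (at t within {0..t + 1})"
    using vector_diff_chain_within[of "\<lambda>s. s + h" 1 t "{0..t + 1}" K "left_op K (t + h)"]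
    by (simp add: o_def)
  then have "((\<lambda>s. K (s + h)) has_vector_derivative left_op K (t + h)) (at t within {0..})"
    by (simp add: at_within_atLeast_eq)
  then have der: "((\<lambda>s. K (s + h) *v v) has_vector_derivative left_op K (t + h) *v v)
      (at t within {0..})"
    by (rule bounded_linear.has_vector_derivative[OF bv])
  have "left_op K (t + h) *v v = (A0 ** K (t + h)) *v v + (A1 ** K (t + h - h)) *v v
      + (\<integral>\<theta>. (G \<theta> ** K (t + h + \<theta>)) *v v \<partial>leb_on {-h..0})"
    by (simp only: left_op_def matrix_vector_mult_add_rdistrib
        integral_bounded_linear[OF bv left_integrable[OF causal_K]])
  also have "\<dots> = A0 *v (K (t + h) *v v) + A1 *v (K (t - h + h) *v v)
      + (LINT \<theta>:{-h..0}|lebesgue. G \<theta> *v (K (t + \<theta> + h) *v v))"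
    by (simp add: set_lint_leb_on matrix_vector_mul_assoc add.commute add.left_commute)
  finally show "((\<lambda>t. K (t + h) *v v) has_vector_derivative
      A0 *v (K (t + h) *v v) + A1 *v (K (t - h + h) *v v)
      + (LINT \<theta>:{-h..0}|lebesgue. G \<theta> *v (K (t + \<theta> + h) *v v))) (at t within {0..})"
    using der by simp
qed

text \<open>
  Stability is applied to each column of \<open>K(t + h)\<close>; the remaining interval \<open>[0, h]\<close> only costs a
  larger constant.
\<close>

lemma exponential_decay:
  assumes "exp_stable h A0 A1 G"
  obtains c b where "c > 0" "b > 0" "\<And>t. norm (K t) \<le> c * exp (- b * t)"
proof -
  obtain \<gamma> b where gb: "\<gamma> > 0" "b > 0" and
    decay: "\<And>x t. delay_solution h A0 A1 G x \<Longrightarrow> t \<ge> 0 \<Longrightarrow>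
        norm (x t) \<le> \<gamma> * exp (- b * t) * (SUP \<theta>\<in>{-h..0}. norm (x \<theta>))"
    using assms unfolding exp_stable_def by blast
  obtain B where B: "B \<ge> 0" "\<forall>t\<le>h. norm (K t) \<le> B"
    using causal_bound[OF causal_K] by blast
  define C where "C = (\<Sum>j\<in>(UNIV :: 'n set). SUP \<theta>\<in>{-h..0}. norm (K (\<theta> + h) *v axis j 1))"
  \<comment> \<open>The factor exp (b * h) undoes the time shift; it also covers t \<le> h, where K is bounded by B.\<close>
  define c where "c = (B + \<gamma> * \<bar>C\<bar> + 1) * exp (b * h)"
  have "norm (K t) \<le> c * exp (- b * t)" for t
  proof (cases "t \<le> h")
    case True
    then have "norm (K t) \<le> (B + \<gamma> * \<bar>C\<bar> + 1) * 1"
      using B gb by (auto intro!: order_trans[OF B(2)[rule_format]])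
    also have "\<dots> \<le> (B + \<gamma> * \<bar>C\<bar> + 1) * exp (b * h - b * t)"
      using True gb B by (intro mult_left_mono) auto
    finally show ?thesis by (simp add: c_def exp_diff exp_minus field_simps)
  next
    case False
    have "norm (K t) \<le> (\<Sum>j\<in>UNIV. norm (K t *v axis j 1))"
      by (rule norm_le_sum_columns)
    also have "\<dots> \<le> (\<Sum>j\<in>UNIV. \<gamma> * exp (- b * (t - h)) * (SUP \<theta>\<in>{-h..0}. norm (K
        (\<theta> + h) *v axis j 1)))"
      using decay[OF delay_solution_K, of "t - h"] False by (intro sum_mono) auto
    also have "\<dots> = (\<gamma> * C) * exp (b * h - b * t)"
      by (simp add: C_def sum_distrib_left algebra_simps)
    also have "\<dots> \<le> (B + \<gamma> * \<bar>C\<bar> + 1) * exp (b * h - b * t)"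
    proof (rule mult_right_mono)
      have "\<gamma> * C \<le> \<gamma> * \<bar>C\<bar>"
        using gb by (intro mult_left_mono) auto
      then show "\<gamma> * C \<le> B + \<gamma> * \<bar>C\<bar> + 1"
        using B(1) by linarith
    qed simp
    finally show ?thesis by (simp add: c_def exp_diff exp_minus field_simps)
  qed
  moreover have "c > 0"
    unfolding c_def using B gb by (intro mult_pos_pos) (auto simp: add_nonneg_pos)
  ultimately show thesis
    using that gb by blast
qed

end

section \<open>Matrix kernels and matrix-linear functionals\<close>

text \<open>
  The common properties of the Lyapunov matrix function \<open>U(\<tau>, M)\<close> and of everything obtained from
  it by shifts in \<open>\<tau>\<close>, by constant matrix factors, and by integration against \<open>G\<close>. They are what
  makes \<open>\<Phi>(s(x), m(x))\<close> integrable for every integrable matrix function \<open>m\<close> and measurable \<open>s\<close>.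
\<close>

definition matrix_kernel :: "(real \<Rightarrow> real^'n^'n \<Rightarrow> real^'n^'n) \<Rightarrow> bool" where
  "matrix_kernel \<Phi> \<longleftrightarrow> (\<lambda>(\<tau>, M). \<Phi> \<tau> M) \<in> borel_measurable (borel \<Otimes>\<^sub>M borel) \<and>
     (\<exists>C\<ge>0. \<forall>\<tau> M. norm (\<Phi> \<tau> M) \<le> C * norm M)"

lemma kernel_measurable:
  assumes "matrix_kernel \<Phi>" and [measurable]: "s \<in> borel_measurable N" "m \<in> borel_measurable N"
  shows "(\<lambda>x. \<Phi> (s x) (m x)) \<in> borel_measurable N"
proof -
  have [measurable]: "(\<lambda>(\<tau>, M). \<Phi> \<tau> M) \<in> borel_measurable (borel \<Otimes>\<^sub>M borel)"
    using assms(1) by (simp add: matrix_kernel_def)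
  have "(\<lambda>x. (\<lambda>(\<tau>, M). \<Phi> \<tau> M) (s x, m x)) \<in> borel_measurable N"
    by measurable
  then show ?thesis by simp
qed

lemma kernel_bound:
  assumes "matrix_kernel \<Phi>"
  obtains C where "C \<ge> 0" "\<And>\<tau> M. norm (\<Phi> \<tau> M) \<le> C * norm M"
  using assms unfolding matrix_kernel_def by blast

lemma kernel_integrable:
  assumes "matrix_kernel \<Phi>" "s \<in> borel_measurable N" "integrable N m"
  shows "integrable N (\<lambda>x. \<Phi> (s x) (m x))"
proof -
  obtain C where "C \<ge> 0" "\<And>\<tau> M. norm (\<Phi> \<tau> M) \<le> C * norm M"
    using kernel_bound[OF assms(1)] by blast
  then show ?thesis
    by (intro integrable_dominated[OF _ kernel_measurable[OF assms(1,2)], of "\<lambda>x. C * norm (m x)"]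
        integrable_mult_right integrable_norm assms(3) borel_measurable_integrable[OF assms(3)])
qed

lemma kernel_add:
  assumes "matrix_kernel \<Phi>" "matrix_kernel \<Psi>"
  shows "matrix_kernel (\<lambda>\<tau> M. \<Phi> \<tau> M + \<Psi> \<tau> M)"
  unfolding matrix_kernel_def
proof
  note [measurable] = assms[THEN kernel_measurable]
  show "(\<lambda>(\<tau>, M). \<Phi> \<tau> M + \<Psi> \<tau> M) \<in> borel_measurable (borel \<Otimes>\<^sub>M borel)"
    by measurable
  obtain C where C: "C \<ge> 0" "\<And>\<tau> M. norm (\<Phi> \<tau> M) \<le> C * norm M"
    using kernel_bound[OF assms(1)] by blast
  obtain D where D: "D \<ge> 0" "\<And>\<tau> M. norm (\<Psi> \<tau> M) \<le> D * norm M"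
    using kernel_bound[OF assms(2)] by blast
  have "norm (\<Phi> \<tau> M + \<Psi> \<tau> M) \<le> (C + D) * norm M" for \<tau> M
    unfolding distrib_right by (rule norm_triangle_mono[OF C(2) D(2)])
  then show "\<exists>C\<ge>0. \<forall>\<tau> M. norm (\<Phi> \<tau> M + \<Psi> \<tau> M) \<le> C * norm M"
    using C(1) D(1) by (intro exI[of _ "C + D"]) simp
qed

lemma kernel_shift:
  assumes "matrix_kernel \<Phi>"
  shows "matrix_kernel (\<lambda>\<tau> M. \<Phi> (\<tau> + a) M)"
  unfolding matrix_kernel_def
proof
  note [measurable] = assms[THEN kernel_measurable]
  show "(\<lambda>(\<tau>, M). \<Phi> (\<tau> + a) M) \<in> borel_measurable (borel \<Otimes>\<^sub>M borel)"
    by measurable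
qed (use assms in \<open>auto simp: matrix_kernel_def\<close>)

lemma kernel_mult:
  assumes "matrix_kernel \<Phi>"
  shows "matrix_kernel (\<lambda>\<tau> M. A ** \<Phi> \<tau> M)" "matrix_kernel (\<lambda>\<tau> M. \<Phi> \<tau> M ** A)"
proof -
  note [measurable] = assms[THEN kernel_measurable]
  obtain C where C: "C \<ge> 0" "\<And>\<tau> M. norm (\<Phi> \<tau> M) \<le> C * norm M"
    using kernel_bound[OF assms(1)] by blast
  have "norm (A ** \<Phi> \<tau> M) \<le> (norm A * C) * norm M" for \<tau> M
    using norm_matrix_mult_le_left[OF C(2)] by (simp add: mult.assoc)
  moreover have "norm (\<Phi> \<tau> M ** A) \<le> (norm A * C) * norm M" for \<tau> M
    using norm_matrix_mult_le_right[OF C(2), of \<tau> M A] by (simp add: ac_simps)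
  moreover have "0 \<le> norm A * C" using C by simp
  moreover have "(\<lambda>(\<tau>, M). A ** \<Phi> \<tau> M) \<in> borel_measurable (borel \<Otimes>\<^sub>M borel)"
    "(\<lambda>(\<tau>, M). \<Phi> \<tau> M ** A) \<in> borel_measurable (borel \<Otimes>\<^sub>M borel)"
    by measurable
  ultimately show "matrix_kernel (\<lambda>\<tau> M. A ** \<Phi> \<tau> M)" "matrix_kernel (\<lambda>\<tau> M. \<Phi> \<tau> M ** A)"
    unfolding matrix_kernel_def by blast+
qed

lemma kernel_weighted_integrable:
  assumes \<Phi>: "matrix_kernel \<Phi>" and [measurable]: "s \<in> borel_measurable N"
    and g: "integrable N g"
  shows "integrable N (\<lambda>x. \<Phi> (s x) M ** g x)" "integrable N (\<lambda>x. transpose (g x) ** \<Phi> (s x) M)"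
proof -
  note [measurable] = kernel_measurable[OF \<Phi>]
  have [measurable]: "g \<in> borel_measurable N" using g by auto
  obtain C where C: "C \<ge> 0" "\<And>\<tau> M. norm (\<Phi> \<tau> M) \<le> C * norm M"
    using kernel_bound[OF \<Phi>] by blast
  have "norm (\<Phi> (s x) M ** g x) \<le> C * norm M * norm (g x)" for x
    by (rule norm_matrix_mult_le_right[OF C(2)])
  moreover have "norm (transpose (g x) ** \<Phi> (s x) M) \<le> C * norm M * norm (g x)" for x
    using norm_matrix_mult_le_left[OF C(2), of "transpose (g x)"] by (simp add: mult.commute)
  moreover have "integrable N (\<lambda>x. C * norm M * norm (g x))"
    using g by simp
  moreover have "(\<lambda>x. \<Phi> (s x) M ** g x) \<in> borel_measurable N"
    "(\<lambda>x. transpose (g x) ** \<Phi> (s x) M) \<in> borel_measurable N"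
    by measurable
  ultimately show "integrable N (\<lambda>x. \<Phi> (s x) M ** g x)" "integrable N (\<lambda>x. transpose (g x) ** \<Phi>
      (s x) M)"
    by (blast intro: integrable_dominated[of N "\<lambda>x. C * norm M * norm (g x)"])+
qed

lemma kernel_weighted_integral:
  assumes \<Phi>: "matrix_kernel \<Phi>" and N: "sigma_finite_measure N"
    and s [measurable]: "s \<in> borel_measurable N" and g: "integrable N g"
  shows "matrix_kernel (\<lambda>\<tau> M. \<integral>x. \<Phi> (\<tau> + s x) M ** g x \<partial>N)"
    and "matrix_kernel (\<lambda>\<tau> M. \<integral>x. transpose (g x) ** \<Phi> (\<tau> + s x) M \<partial>N)"
proof -
  interpret sigma_finite_measure N by (rule N)
  note [measurable] = kernel_measurable[OF \<Phi>]
  have [measurable]: "g \<in> borel_measurable N" using g by auto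
  obtain C where C: "C \<ge> 0" "\<And>\<tau> M. norm (\<Phi> \<tau> M) \<le> C * norm M"
    using kernel_bound[OF \<Phi>] by blast
  define D where "D = C * (\<integral>x. norm (g x) \<partial>N)"
  have D: "D \<ge> 0" unfolding D_def using C by simp
  have int: "integrable N (\<lambda>x. C * norm M * norm (g x))" for M :: "real^'n^'n"
    using g by simp
  have DM: "(\<integral>x. C * norm M * norm (g x) \<partial>N) = D * norm M" for M :: "real^'n^'n"
    by (simp add: D_def)
  have s': "(\<lambda>x. \<tau> + s x) \<in> borel_measurable N" for \<tau> by measurable
  have b1: "norm (\<integral>x. \<Phi> (\<tau> + s x) M ** g x \<partial>N) \<le> D * norm M" for \<tau> M
  proof -
    have "norm (\<integral>x. \<Phi> (\<tau> + s x) M ** g x \<partial>N) \<le> (\<integral>x. norm (\<Phi> (\<tau> + s x) M ** g x) \<partial>N)"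
      by (rule integral_norm_bound)
    also have "\<dots> \<le> (\<integral>x. C * norm M * norm (g x) \<partial>N)"
    proof (rule integral_mono[OF integrable_norm[OF kernel_weighted_integrable(1)[OF \<Phi> s' g]] int])
      show "norm (\<Phi> (\<tau> + s x) M ** g x) \<le> C * norm M * norm (g x)" for x
        by (rule norm_matrix_mult_le_right[OF C(2)])
    qed
    finally show ?thesis by (simp only: DM)
  qed
  have b2: "norm (\<integral>x. transpose (g x) ** \<Phi> (\<tau> + s x) M \<partial>N) \<le> D * norm M" for \<tau> M
  proof -
    have "norm (\<integral>x. transpose (g x) ** \<Phi> (\<tau> + s x) M \<partial>N)
        \<le> (\<integral>x. norm (transpose (g x) ** \<Phi> (\<tau> + s x) M) \<partial>N)"
      by (rule integral_norm_bound)
    also have "\<dots> \<le> (\<integral>x. C * norm M * norm (g x) \<partial>N)"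
    proof (rule integral_mono[OF integrable_norm[OF kernel_weighted_integrable(2)[OF \<Phi> s' g]] int])
      show "norm (transpose (g x) ** \<Phi> (\<tau> + s x) M) \<le> C * norm M * norm (g x)" for x
        using norm_matrix_mult_le_left[OF C(2), of "transpose (g x)"] by (simp add: mult.commute)
    qed
    finally show ?thesis by (simp only: DM)
  qed
  have "(\<lambda>(\<tau>, M). \<integral>x. \<Phi> (\<tau> + s x) M ** g x \<partial>N) \<in> borel_measurable (borel \<Otimes>\<^sub>M borel)"
    "(\<lambda>(\<tau>, M). \<integral>x. transpose (g x) ** \<Phi> (\<tau> + s x) M \<partial>N) \<in> borel_measurable (borel \<Otimes>\<^sub>M borel)"
    by measurable
  with D b1 b2 show "matrix_kernel (\<lambda>\<tau> M. \<integral>x. \<Phi> (\<tau> + s x) M ** g x \<partial>N)"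
    "matrix_kernel (\<lambda>\<tau> M. \<integral>x. transpose (g x) ** \<Phi> (\<tau> + s x) M \<partial>N)"
    unfolding matrix_kernel_def by blast+
qed

text \<open>
  Only kernels occur as arguments, because the functionals of interest are integrals and are
  additive on integrable functions only.
\<close>

definition matrix_linear ::
  "((real \<Rightarrow> real^'n^'n \<Rightarrow> real^'n^'n) \<Rightarrow> real^'n^'n) \<Rightarrow> bool" where
  "matrix_linear J \<longleftrightarrow>
     (\<forall>\<Phi> \<Psi>. matrix_kernel \<Phi> \<longrightarrow> matrix_kernel \<Psi> \<longrightarrow> J (\<lambda>\<tau> M. \<Phi> \<tau> M + \<Psi> \<tau> M) = J \<Phi> + J \<Psi>) \<and>
     (\<forall>A \<Phi>. matrix_kernel \<Phi> \<longrightarrow> J (\<lambda>\<tau> M. A ** \<Phi> \<tau> M) = A ** J \<Phi>) \<and>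
     (\<forall>A \<Phi>. matrix_kernel \<Phi> \<longrightarrow> J (\<lambda>\<tau> M. \<Phi> \<tau> M ** A) = J \<Phi> ** A)"

lemma matrix_linear_eval: "matrix_linear (\<lambda>\<Phi>. \<Phi> s m)"
  by (simp add: matrix_linear_def)

lemma matrix_linear_integral:
  assumes "s \<in> borel_measurable N" "integrable N m"
  shows "matrix_linear (\<lambda>\<Phi>. \<integral>x. \<Phi> (s x) (m x) \<partial>N)"
  unfolding matrix_linear_def
  using kernel_integrable[OF _ assms]
  by (simp add: integral_bounded_linear[OF mm.bounded_linear_left]
      integral_bounded_linear[OF mm.bounded_linear_right])

lemma kernel_double_integrable:
  assumes N: "sigma_finite_measure N" and \<Phi>: "matrix_kernel \<Phi>"
    and [measurable]: "(\<lambda>(x, y). s x y) \<in> borel_measurable (N \<Otimes>\<^sub>M N)"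
      "(\<lambda>(x, y). m x y) \<in> borel_measurable (N \<Otimes>\<^sub>M N)"
    and uv: "integrable N u" "integrable N v" "\<And>x y. norm (m x y) \<le> u x * v y"
  shows "integrable N (\<lambda>x. \<integral>y. \<Phi> (s x y) (m x y) \<partial>N)"
    and "\<And>x. x \<in> space N \<Longrightarrow> integrable N (\<lambda>y. \<Phi> (s x y) (m x y))"
proof -
  note [measurable] = kernel_measurable[OF \<Phi>]
  obtain C where C: "C \<ge> 0" "\<And>\<tau> M. norm (\<Phi> \<tau> M) \<le> C * norm M"
    using kernel_bound[OF \<Phi>] by blast
  have meas: "(\<lambda>(x, y). \<Phi> (s x y) (m x y)) \<in> borel_measurable (N \<Otimes>\<^sub>M N)"
    by measurable
  have bd: "norm (\<Phi> (s x y) (m x y)) \<le> (C * u x) * v y" for x y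
    using order_trans[OF C(2) mult_left_mono[OF uv(3) C(1)]] by (simp add: mult.assoc)
  have u: "integrable N (\<lambda>x. C * u x)" using uv by simp
  note * = integrable_product_dominated[OF N N meas u uv(2) bd]
  show "integrable N (\<lambda>x. \<integral>y. \<Phi> (s x y) (m x y) \<partial>N)"
    and "\<And>x. x \<in> space N \<Longrightarrow> integrable N (\<lambda>y. \<Phi> (s x y) (m x y))"
    using *(3,4) by auto
qed

lemma matrix_linear_double_integral:
  fixes m :: "'a \<Rightarrow> 'a \<Rightarrow> real^'n^'n"
  assumes N: "sigma_finite_measure N"
    and s: "(\<lambda>(x, y). s x y) \<in> borel_measurable (N \<Otimes>\<^sub>M N)"
    and m: "(\<lambda>(x, y). m x y) \<in> borel_measurable (N \<Otimes>\<^sub>M N)"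
    and uv: "integrable N u" "integrable N v" "\<And>x y. norm (m x y) \<le> u x * v y"
  shows "matrix_linear (\<lambda>\<Phi>. \<integral>x. (\<integral>y. \<Phi> (s x y) (m x y) \<partial>N) \<partial>N)"
  unfolding matrix_linear_def
proof (intro conjI allI impI)
  note int = kernel_double_integrable[OF N _ s m uv]
  fix \<Phi> \<Psi> :: "real \<Rightarrow> real^'n^'n \<Rightarrow> real^'n^'n" and A :: "real^'n^'n"
  assume \<Phi>: "matrix_kernel \<Phi>"
  show "(\<integral>x. (\<integral>y. \<Phi> (s x y) (m x y) + \<Psi> (s x y) (m x y) \<partial>N) \<partial>N) =
      (\<integral>x. (\<integral>y. \<Phi> (s x y) (m x y) \<partial>N) \<partial>N) + (\<integral>x. (\<integral>y. \<Psi> (s x y) (m x y) \<partial>N) \<partial>N)"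
    if \<Psi>: "matrix_kernel \<Psi>"
    using int[OF \<Phi>] int[OF \<Psi>] by (simp cong: Bochner_Integration.integral_cong)
  have "(\<integral>x. (\<integral>y. A ** \<Phi> (s x y) (m x y) \<partial>N) \<partial>N) = (\<integral>x. A ** (\<integral>y. \<Phi> (s x y) (m x y) \<partial>N) \<partial>N)"
    by (intro Bochner_Integration.integral_cong refl integral_bounded_linear[OF
        mm.bounded_linear_right] int(2)[OF \<Phi>])
  then show "(\<integral>x. (\<integral>y. A ** \<Phi> (s x y) (m x y) \<partial>N) \<partial>N) = A ** (\<integral>x. (\<integral>y. \<Phi> (s x y) (m x y) \<partial>N) \<partial>N)"
    by (simp add: integral_bounded_linear[OF mm.bounded_linear_right int(1)[OF \<Phi>]])
  have "(\<integral>x. (\<integral>y. \<Phi> (s x y) (m x y) ** A \<partial>N) \<partial>N) = (\<integral>x. (\<integral>y. \<Phi> (s x y) (m x y) \<partial>N) ** A \<partial>N)"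
    by (intro Bochner_Integration.integral_cong refl integral_bounded_linear[OF
        mm.bounded_linear_left] int(2)[OF \<Phi>])
  then show "(\<integral>x. (\<integral>y. \<Phi> (s x y) (m x y) ** A \<partial>N) \<partial>N) = (\<integral>x. (\<integral>y. \<Phi> (s x y) (m x y) \<partial>N) \<partial>N) ** A"
    by (simp add: integral_bounded_linear[OF mm.bounded_linear_left int(1)[OF \<Phi>]])
qed

section \<open>Correlation integrals of the fundamental matrix\<close>

locale decaying_matrix =
  fixes K :: "real \<Rightarrow> real^'n^'n" and c b :: real
  assumes K_meas [measurable]: "K \<in> borel_measurable borel"
    and K_zero: "\<And>t. t < 0 \<Longrightarrow> K t = 0"
    and K_decay: "\<And>t. norm (K t) \<le> c * exp (- b * t)"
    and c_pos: "c > 0" and b_pos: "b > 0"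
begin

abbreviation half_line where "half_line \<equiv> leb_on {0..}"

lemma sigma_finite_half_line: "sigma_finite_measure half_line"
  by (rule sigma_finite_leb_on) auto

lemma K_bound: "norm (K t) \<le> c"
proof (cases "t < 0")
  case True
  then show ?thesis using c_pos by (simp add: K_zero)
next
  case False
  then have "c * exp (- b * t) \<le> c * 1"
    using b_pos c_pos by (intro mult_left_mono) auto
  then show ?thesis using K_decay[of t] by simp
qed

text \<open>
  An integrable majorant of \<open>K\<close> on the half-line. A shift of the argument by \<open>a\<close> multiplies it by
  the constant \<open>exp (- b * a)\<close>, also where \<open>t + a\<close> is negative, so that shifted factors still have
  majorants of product form.
\<close>

definition envelope :: "real \<Rightarrow> real" where "envelope t = c * exp (- b * t)"

lemma integrable_envelope: "integrable half_line envelope"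
proof -
  have "(\<lambda>t. exp (- b * t)) absolutely_integrable_on {0..}"
    by (intro nonnegative_absolutely_integrable_1 integrable_on_exp_minus_to_infinity b_pos) auto
  then have "integrable half_line (\<lambda>t. exp (- b * t))"
    by (simp add: set_integrable_leb_on)
  then show ?thesis unfolding envelope_def by (rule integrable_mult_right)
qed

lemma envelope_nonneg: "envelope t \<ge> 0"
  using c_pos by (simp add: envelope_def)

lemma K_shift_le_envelope: "norm (K (t + a)) \<le> exp (- b * a) * envelope t"
  using K_decay[of "t + a"] by (simp add: envelope_def exp_add[symmetric] algebra_simps)

text \<open>
  The Lyapunov matrix function with the right factor \<open>K\<close> replaced by \<open>F\<close>. With \<open>F\<close> equal to
  \<open>Khat\<close> it covers the integrals in \<open>\<Pi>1\<close> and the right half of those in \<open>\<Pi>2\<close>.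
\<close>

definition correlation :: "(real \<Rightarrow> real^'n^'n) \<Rightarrow> real \<Rightarrow> real^'n^'n \<Rightarrow> real^'n^'n" where
  "correlation F \<tau> M = (\<integral>t. transpose (K t) ** M ** F (t + \<tau>) \<partial>half_line)"

lemma correlation_K: "correlation K = lyap_matrix K"
  by (intro ext) (simp add: correlation_def lyap_matrix_def set_lint_leb_on)

lemma triple_bound:
  assumes "norm A \<le> x" "norm B \<le> y" "norm C \<le> z"
  shows "norm ((A :: real^'n^'n) ** (B :: real^'n^'n) ** (C :: real^'n^'n)) \<le> x * y * z"
proof -
  have "0 \<le> x" "0 \<le> y"
    using assms norm_ge_zero order_trans by blast+
  then have "norm A * norm B * norm C \<le> x * y * z"
    using assms by (intro mult_mono) auto
  with norm_mult3_le show ?thesis by (rule order_trans)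
qed

lemma correlation_integrable:
  fixes F :: "real \<Rightarrow> real^'n^'n"
  assumes [measurable]: "F \<in> borel_measurable borel" and B: "\<And>t. norm (F t) \<le> B"
  shows "integrable half_line (\<lambda>t. transpose (K (t + a)) ** M ** F (t + \<tau>))"
proof (rule integrable_dominated)
  show "integrable half_line (\<lambda>t. exp (- b * a) * envelope t * norm M * B)"
    using integrable_envelope by simp
  show "norm (transpose (K (t + a)) ** M ** F (t + \<tau>)) \<le> exp (- b * a) * envelope t * norm M * B"
      for t
    by (rule triple_bound) (use K_shift_le_envelope B in auto)
qed measurable

lemma integral_half_line:
  fixes g :: "real \<Rightarrow> real^'n^'n"
  assumes "g \<in> borel_measurable borel" "\<And>t. t < 0 \<Longrightarrow> g t = 0"
  shows "integral\<^sup>L half_line g = integral\<^sup>L lborel g"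
proof -
  have "integral\<^sup>L half_line g = (\<integral>t. indicator {0..} t *\<^sub>R g t \<partial>lebesgue)"
    by (simp add: integral_restrict_space)
  also have "\<dots> = integral\<^sup>L lebesgue g"
    using assms(2) by (intro Bochner_Integration.integral_cong) (auto simp: indicator_def)
  also have "\<dots> = integral\<^sup>L lborel g"
    using assms(1) by (intro integral_completion) simp
  finally show ?thesis .
qed

text \<open>
  For \<open>a \<le> 0\<close> the integrand vanishes for negative \<open>t\<close>, before and after the translation by \<open>a\<close>, so
  the integrals over the half-line are integrals over the whole line. For \<open>a > 0\<close> the part of the
  integral over \<open>[0, a]\<close> would be lost.
\<close>

lemma correlation_shift:
  assumes [measurable]: "F \<in> borel_measurable borel" and "a \<le> 0"
  shows "(\<integral>t. transpose (K (t + a)) ** M ** F (t + s) \<partial>half_line) = correlation F (s - a) M"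
proof -
  have "(\<integral>t. transpose (K (t + a)) ** M ** F (t + s) \<partial>half_line)
      = (\<integral>t. transpose (K (t + a)) ** M ** F (t + s) \<partial>lborel)"
    using \<open>a \<le> 0\<close> by (intro integral_half_line) (auto simp: K_zero)
  also have "\<dots> = (\<integral>t. transpose (K t) ** M ** F (t + (s - a)) \<partial>lborel)"
    by (subst lborel_shift[symmetric, of _ "- a"]) (simp add: algebra_simps)
  also have "\<dots> = correlation F (s - a) M"
    unfolding correlation_def
    by (intro integral_half_line[symmetric]) (auto simp: K_zero)
  finally show ?thesis .
qed

lemma kernel_correlation:
  assumes [measurable]: "F \<in> borel_measurable borel" and B: "\<And>t. norm (F t) \<le> B"
  shows "matrix_kernel (correlation F)"
  unfolding matrix_kernel_def
proof
  interpret sigma_finite_measure half_line by (rule sigma_finite_half_line)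
  have "B \<ge> 0" using B[of 0] norm_ge_zero order_trans by blast
  show "(\<lambda>(\<tau>, M). correlation F \<tau> M) \<in> borel_measurable (borel \<Otimes>\<^sub>M borel)"
    unfolding correlation_def by measurable
  define C where "C = (\<integral>t. envelope t \<partial>half_line) * B"
  have "norm (correlation F \<tau> M) \<le> C * norm M" for \<tau> M
  proof -
    have "norm (correlation F \<tau> M) \<le> (\<integral>t. envelope t * norm M * B \<partial>half_line)"
      unfolding correlation_def
    proof (rule Bochner_Integration.integral_norm_bound_integral)
      show "integrable half_line (\<lambda>t. transpose (K t) ** M ** F (t + \<tau>))"
        using correlation_integrable[OF assms, of 0] by simp
      show "norm (transpose (K t) ** M ** F (t + \<tau>)) \<le> envelope t * norm M * B" for t
        by (rule triple_bound) (use K_shift_le_envelope[of t 0] B in auto)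
    qed (use integrable_envelope in auto)
    then show ?thesis by (simp add: C_def ac_simps)
  qed
  moreover have "C \<ge> 0"
    unfolding C_def using \<open>B \<ge> 0\<close> envelope_nonneg by simp
  ultimately show "\<exists>C\<ge>0. \<forall>\<tau> M. norm (correlation F \<tau> M) \<le> C * norm M"
    by blast
qed

end

locale decaying_delay = decaying_matrix K c b + delay_kernel h A0 A1 G
  for K :: "real \<Rightarrow> real^'n^'n" and c b h :: real and A0 A1 :: "real^'n^'n" and G :: "real \<Rightarrow>
      real^'n^'n"
begin

abbreviation delay_interval where "delay_interval \<equiv> leb_on {-h..0}"
abbreviation U where "U \<equiv> lyap_matrix K"

lemma G_integrable:
  assumes "\<theta> \<in> {-h..0}"
  shows "integrable (leb_on {-h..\<theta>}) G"
proof -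
  have "set_integrable lebesgue {-h..0} G"
    using G_int by (simp add: set_integrable_leb_on)
  then have "set_integrable lebesgue {-h..\<theta>} G"
    by (rule set_integrable_subset) (use assms in auto)
  then show ?thesis by (simp add: set_integrable_leb_on)
qed

lemma sigma_finite_Icc: "sigma_finite_measure (leb_on {-h..\<theta>})"
  by (rule sigma_finite_leb_on) auto

lemma Khat_eq: "Khat h A1 G K t \<theta> = K (t - \<theta> - h) ** A1
    + (\<integral>\<delta>. K (t - \<theta> + \<delta>) ** G \<delta> \<partial>leb_on {-h..\<theta>})"
  by (simp add: Khat_def set_lint_leb_on)

lemma KG_integrable:
  assumes "\<theta> \<in> {-h..0}"
  shows "integrable (leb_on {-h..\<theta>}) (\<lambda>\<delta>. K (s + \<delta>) ** G \<delta>)"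
proof (rule integrable_dominated)
  note [measurable] = borel_measurable_integrable[OF G_integrable[OF assms]]
  show "integrable (leb_on {-h..\<theta>}) (\<lambda>\<delta>. c * norm (G \<delta>))"
    using G_integrable[OF assms] by simp
  show "(\<lambda>\<delta>. K (s + \<delta>) ** G \<delta>) \<in> borel_measurable (leb_on {-h..\<theta>})"
    by measurable
  show "norm (K (s + \<delta>) ** G \<delta>) \<le> c * norm (G \<delta>)" for \<delta>
    by (rule order_trans[OF norm_matrix_mult_le mult_right_mono[OF K_bound norm_ge_zero]])
qed

lemma Khat_measurable:
  assumes "\<theta> \<in> {-h..0}"
  shows "(\<lambda>t. Khat h A1 G K t \<theta>) \<in> borel_measurable borel"
proof -
  interpret S: sigma_finite_measure "leb_on {-h..\<theta>}" by (rule sigma_finite_Icc)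
  note [measurable] = borel_measurable_integrable[OF G_integrable[OF assms]]
  show ?thesis unfolding Khat_eq by measurable
qed

lemma Khat_bounded:
  assumes "\<theta> \<in> {-h..0}"
  shows "\<exists>B. \<forall>t. norm (Khat h A1 G K t \<theta>) \<le> B"
proof (intro exI allI)
  fix t
  show "norm (Khat h A1 G K t \<theta>) \<le> c * norm A1 + (\<integral>\<delta>. c * norm (G \<delta>) \<partial>leb_on {-h..\<theta>})"
    unfolding Khat_eq
  proof (intro norm_triangle_mono Bochner_Integration.integral_norm_bound_integral KG_integrable
      assms)
    show "norm (K (t - \<theta> - h) ** A1) \<le> c * norm A1"
      by (rule order_trans[OF norm_matrix_mult_le mult_right_mono[OF K_bound norm_ge_zero]])
    show "norm (K (t - \<theta> + \<delta>) ** G \<delta>) \<le> c * norm (G \<delta>)" for \<delta>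
      by (rule order_trans[OF norm_matrix_mult_le mult_right_mono[OF K_bound norm_ge_zero]])
  qed (use G_integrable[OF assms] in auto)
qed

lemma kernel_U: "matrix_kernel U"
  using kernel_correlation[OF K_meas K_bound] by (simp add: correlation_K)

text \<open>
  The delay Lyapunov matrix function with \<open>K\<close> replaced by \<open>Khat\<close> in the right factor, already
  written in terms of \<open>U\<close>.
\<close>

definition lyap_hat_right :: "real \<Rightarrow> real \<Rightarrow> real^'n^'n \<Rightarrow> real^'n^'n" where
  "lyap_hat_right \<theta> \<tau> M = U (\<tau> + (- \<theta> - h)) M ** A1
     + (\<integral>\<delta>. U (\<tau> + (- \<theta> + \<delta>)) M ** G \<delta> \<partial>leb_on {-h..\<theta>})"

lemma correlation_Khat:
  assumes \<theta>: "\<theta> \<in> {-h..0}"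
  shows "correlation (\<lambda>t. Khat h A1 G K t \<theta>) = lyap_hat_right \<theta>"
proof (intro ext)
  fix \<tau> M
  let ?S = "leb_on {-h..\<theta>}"
  note [measurable] = borel_measurable_integrable[OF G_integrable[OF \<theta>]]
  have m: "(\<lambda>(t, \<delta>). transpose (K t) ** M ** K (t + (\<tau> + (- \<theta> + \<delta>))) ** G \<delta>)
      \<in> borel_measurable (half_line \<Otimes>\<^sub>M ?S)"
    by measurable
  have bd: "norm (transpose (K t) ** M ** K (t + (\<tau> + (- \<theta> + \<delta>))) ** G \<delta>)
      \<le> (envelope t * norm M * c) * norm (G \<delta>)" for t \<delta>
    by (intro order_trans[OF norm_matrix_mult_le] mult_right_mono triple_bound)
       (use K_shift_le_envelope[of t 0] K_bound in auto)
  have e: "integrable half_line (\<lambda>t. envelope t * norm M * c)"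
    using integrable_envelope by simp
  note F = integrable_product_dominated[OF sigma_finite_half_line sigma_finite_Icc m e
      integrable_norm[OF G_integrable[OF \<theta>]] bd]
  have i1: "integrable half_line (\<lambda>t. transpose (K t) ** M ** K (t + s))" for s
    using correlation_integrable[OF K_meas K_bound, of 0] by simp
  have "correlation (\<lambda>t. Khat h A1 G K t \<theta>) \<tau> M
     = (\<integral>t. transpose (K t) ** M ** K (t + (\<tau> + (- \<theta> - h))) ** A1
        + (\<integral>\<delta>. transpose (K t) ** M ** K (t + (\<tau> + (- \<theta> + \<delta>))) ** G \<delta> \<partial>?S) \<partial>half_line)"
    unfolding correlation_def Khat_eq
  proof (intro Bochner_Integration.integral_cong refl)
    fix t
    have "(\<integral>\<delta>. transpose (K t) ** M ** (K (t + \<tau> - \<theta> + \<delta>) ** G \<delta>) \<partial>?S)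
        = transpose (K t) ** M ** (\<integral>\<delta>. K (t + \<tau> - \<theta> + \<delta>) ** G \<delta> \<partial>?S)"
      by (rule integral_bounded_linear[OF mm.bounded_linear_right KG_integrable[OF \<theta>]])
    then show "transpose (K t) ** M ** (K (t + \<tau> - \<theta> - h) ** A1
        + (\<integral>\<delta>. K (t + \<tau> - \<theta> + \<delta>) ** G \<delta> \<partial>?S))
      = transpose (K t) ** M ** K (t + (\<tau> + (- \<theta> - h))) ** A1
        + (\<integral>\<delta>. transpose (K t) ** M ** K (t + (\<tau> + (- \<theta> + \<delta>))) ** G \<delta> \<partial>?S)"
      by (simp add: mm.add_right matrix_mul_assoc algebra_simps)
  qed
  also have "\<dots> = (\<integral>t. transpose (K t) ** M ** K (t + (\<tau> + (- \<theta> - h))) ** A1 \<partial>half_line)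
        + (\<integral>t. \<integral>\<delta>. transpose (K t) ** M ** K (t + (\<tau> + (- \<theta> + \<delta>))) ** G \<delta> \<partial>?S \<partial>half_line)"
    by (intro Bochner_Integration.integral_add F(3) integrable_bounded_linear[OF
        mm.bounded_linear_left] i1)

  also have "(\<integral>t. transpose (K t) ** M ** K (t + (\<tau> + (- \<theta> - h))) ** A1 \<partial>half_line) = U (\<tau>
      + (- \<theta> - h)) M ** A1"
    unfolding correlation_K[symmetric] correlation_def
    by (rule integral_bounded_linear[OF mm.bounded_linear_left i1])
  also have "(\<integral>t. \<integral>\<delta>. transpose (K t) ** M ** K (t + (\<tau> + (- \<theta> + \<delta>))) ** G \<delta> \<partial>?S \<partial>half_line)
     = (\<integral>\<delta>. \<integral>t. transpose (K t) ** M ** K (t + (\<tau> + (- \<theta> + \<delta>))) ** G \<delta> \<partial>half_line \<partial>?S)"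
    by (rule F(2))
  also have "\<dots> = (\<integral>\<delta>. U (\<tau> + (- \<theta> + \<delta>)) M ** G \<delta> \<partial>?S)"
    unfolding correlation_K[symmetric] correlation_def
    by (simp add: integral_bounded_linear[OF mm.bounded_linear_left i1])
  finally show "correlation (\<lambda>t. Khat h A1 G K t \<theta>) \<tau> M = lyap_hat_right \<theta> \<tau> M"
    by (simp add: lyap_hat_right_def)
qed

text \<open>
  The counterpart of \<open>correlation_Khat\<close> for the left factor. Here the sign condition of
  \<open>correlation_shift\<close> matters: the shifts are \<open>a - \<xi> - h\<close> and \<open>a - \<xi> + \<delta>\<close>, nonpositive because
  \<open>\<xi> \<ge> - h\<close> and \<open>\<delta> \<le> \<xi>\<close>.
\<close>

lemma correlation_left_Khat:
  assumes \<xi>: "\<xi> \<in> {-h..0}" and a: "a \<le> 0"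
    and F [measurable]: "F \<in> borel_measurable borel" and B: "\<And>t. norm (F t) \<le> B"
  shows "(\<integral>t. transpose (Khat h A1 G K (t + a) \<xi>) ** M ** F (t + s) \<partial>half_line)
     = transpose A1 ** correlation F ((s - a) + (\<xi> + h)) M
       + (\<integral>\<delta>. transpose (G \<delta>) ** correlation F ((s - a) + (\<xi> - \<delta>)) M \<partial>leb_on {-h..\<xi>})"
proof -
  let ?S = "leb_on {-h..\<xi>}"
  note [measurable] = borel_measurable_integrable[OF G_integrable[OF \<xi>]]
  have m: "(\<lambda>(t, \<delta>). transpose (G \<delta>) ** (transpose (K (t + (a - \<xi> + \<delta>))) ** M ** F (t + s)))
      \<in> borel_measurable (half_line \<Otimes>\<^sub>M ?S)"
    by measurable
  have "B \<ge> 0" using B[of 0] norm_ge_zero order_trans by blast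
  have bd: "norm (transpose (G \<delta>) ** (transpose (K (t + (a - \<xi> + \<delta>))) ** M ** F (t + s)))
      \<le> (exp (- b * (a - \<xi> - h)) * envelope t * norm M * B) * norm (G \<delta>)" if "\<delta> \<in> space ?S" for t \<delta>
  proof -
    have "- b * (a - \<xi> + \<delta>) \<le> - b * (a - \<xi> - h)"
      using that b_pos by (auto simp: space_restrict_space)
    then have "exp (- b * (a - \<xi> + \<delta>)) * envelope t \<le> exp (- b * (a - \<xi> - h)) * envelope t"
      using envelope_nonneg by (intro mult_right_mono) auto
    with K_shift_le_envelope have "norm (K (t + (a - \<xi> + \<delta>)))
        \<le> exp (- b * (a - \<xi> - h)) * envelope t"
      by (rule order_trans)
    then have "norm (transpose (K (t + (a - \<xi> + \<delta>))) ** M ** F (t + s))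
        \<le> exp (- b * (a - \<xi> - h)) * envelope t * norm M * B"
      using B by (intro triple_bound) auto
    then have "norm (G \<delta>) * norm (transpose (K (t + (a - \<xi> + \<delta>))) ** M ** F (t + s))
        \<le> norm (G \<delta>) * (exp (- b * (a - \<xi> - h)) * envelope t * norm M * B)"
      by (rule mult_left_mono) simp
    then show ?thesis
      by (intro order_trans[OF norm_matrix_mult_le]) (simp add: mult.commute)
  qed
  have e: "integrable half_line (\<lambda>t. exp (- b * (a - \<xi> - h)) * envelope t * norm M * B)"
    using integrable_envelope by simp
  note FU = integrable_product_dominated[OF sigma_finite_half_line sigma_finite_Icc m e
      integrable_norm[OF G_integrable[OF \<xi>]] bd]
  have i1: "integrable half_line (\<lambda>t. transpose (K (t + a)) ** M ** F (t + s))" for a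
    by (rule correlation_integrable[OF F B])
  have "(\<integral>t. transpose (Khat h A1 G K (t + a) \<xi>) ** M ** F (t + s) \<partial>half_line)
     = (\<integral>t. transpose A1 ** (transpose (K (t + (a - \<xi> - h))) ** M ** F (t + s))
        + (\<integral>\<delta>. transpose (G \<delta>) ** (transpose (K (t + (a - \<xi> + \<delta>))) ** M ** F (t + s)) \<partial>?S)
            \<partial>half_line)"
  proof (intro Bochner_Integration.integral_cong refl)
    fix t
    have "bounded_linear (\<lambda>X :: real^'n^'n. transpose X ** M ** F (t + s))"
      by (intro bounded_linear_compose[OF mm.bounded_linear_left bounded_linear_compose[OF
          mm.bounded_linear_left]]
          bounded_linear_transpose)
    from integral_bounded_linear[OF this KG_integrable[OF \<xi>, of "t + a - \<xi>"]]
    have "transpose (\<integral>\<delta>. K (t + a - \<xi> + \<delta>) ** G \<delta> \<partial>?S) ** M ** F (t + s)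
        = (\<integral>\<delta>. transpose (G \<delta>) ** (transpose (K (t + (a - \<xi> + \<delta>))) ** M ** F (t + s)) \<partial>?S)"
      by (simp add: matrix_transpose_mul matrix_mul_assoc algebra_simps)
    then show "transpose (Khat h A1 G K (t + a) \<xi>) ** M ** F (t + s)
      = transpose A1 ** (transpose (K (t + (a - \<xi> - h))) ** M ** F (t + s))
        + (\<integral>\<delta>. transpose (G \<delta>) ** (transpose (K (t + (a - \<xi> + \<delta>))) ** M ** F (t + s)) \<partial>?S)"
      by (simp add: Khat_eq transpose_add mm.add_left matrix_transpose_mul matrix_mul_assoc
          algebra_simps)
  qed
  also have "\<dots> = (\<integral>t. transpose A1 ** (transpose (K (t + (a - \<xi> - h))) ** M ** F (t + s))
      \<partial>half_line)
        + (\<integral>t. \<integral>\<delta>. transpose (G \<delta>) ** (transpose (K (t + (a - \<xi> + \<delta>))) ** M ** F (t + s)) \<partial>?S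
            \<partial>half_line)"
    by (intro Bochner_Integration.integral_add FU(3) integrable_bounded_linear[OF
        mm.bounded_linear_right] i1)
  also have "(\<integral>t. transpose A1 ** (transpose (K (t + (a - \<xi> - h))) ** M ** F (t + s)) \<partial>half_line)
     = transpose A1 ** correlation F ((s - a) + (\<xi> + h)) M"
    using \<xi> a by (subst integral_bounded_linear[OF mm.bounded_linear_right i1], subst
        correlation_shift)
      (auto simp: algebra_simps F)
  also have "(\<integral>t. \<integral>\<delta>. transpose (G \<delta>) ** (transpose (K (t
      + (a - \<xi> + \<delta>))) ** M ** F (t + s)) \<partial>?S \<partial>half_line)
     = (\<integral>\<delta>. \<integral>t. transpose (G \<delta>) ** (transpose (K (t + (a - \<xi> + \<delta>))) ** M ** F (t + s)) \<partial>half_line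
         \<partial>?S)"
    by (rule FU(2))
  also have "\<dots> = (\<integral>\<delta>. transpose (G \<delta>) ** correlation F ((s - a) + (\<xi> - \<delta>)) M \<partial>?S)"
  proof (intro Bochner_Integration.integral_cong refl)
    fix \<delta> assume "\<delta> \<in> space ?S"
    then have "a - \<xi> + \<delta> \<le> 0" using a by (simp add: space_restrict_space)
    then show "(\<integral>t. transpose (G \<delta>) ** (transpose (K (t
        + (a - \<xi> + \<delta>))) ** M ** F (t + s)) \<partial>half_line)
        = transpose (G \<delta>) ** correlation F ((s - a) + (\<xi> - \<delta>)) M"
      by (subst integral_bounded_linear[OF mm.bounded_linear_right i1], subst correlation_shift)
        (auto simp: algebra_simps F)
  qed
  finally show ?thesis .
qed

end

section \<open>Expansion of the correlations into Lyapunov matrices\<close>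

context decaying_delay
begin

lemma kernel_U_Khat:
  assumes "\<theta> \<in> {-h..0}"
  shows "matrix_kernel (\<lambda>\<tau> M. \<integral>\<delta>. U (\<tau> + (- \<theta> + \<delta>)) M ** G \<delta> \<partial>leb_on {-h..\<theta>})"
  by (rule kernel_weighted_integral(1)[OF kernel_U sigma_finite_Icc _ G_integrable[OF assms]])
      measurable

lemma mult_integral_U:
  assumes "\<theta> \<in> {-h..0}"
  shows "X ** (\<integral>\<delta>. U (s + (- \<theta> + \<delta>)) M ** G \<delta> \<partial>leb_on {-h..\<theta>})
      = (\<integral>\<delta>. X ** U (s + (- \<theta> + \<delta>)) M ** G \<delta> \<partial>leb_on {-h..\<theta>})"
proof -
  have "integrable (leb_on {-h..\<theta>}) (\<lambda>\<delta>. U (s + (- \<theta> + \<delta>)) M ** G \<delta>)"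
    by (rule kernel_weighted_integrable(1)[OF kernel_U _ G_integrable[OF assms]]) measurable
  from integral_bounded_linear[OF mm.bounded_linear_right this, symmetric]
  show ?thesis by (simp only: matrix_mul_assoc[symmetric])
qed

lemma integral_U_mult:
  assumes "\<xi> \<in> {-h..0}"
  shows "(\<integral>\<delta>. transpose (G \<delta>) ** U (\<tau> + (\<xi> - \<delta> - \<theta> - h)) M \<partial>leb_on {-h..\<xi>}) ** A
      = (\<integral>\<delta>. transpose (G \<delta>) ** U (\<tau> + (\<xi> - \<delta> - \<theta> - h)) M ** A \<partial>leb_on {-h..\<xi>})"
proof -
  have "integrable (leb_on {-h..\<xi>}) (\<lambda>\<delta>. transpose (G \<delta>) ** U (\<tau> + (\<xi> - \<delta> - \<theta> - h)) M)"
    by (rule kernel_weighted_integrable(2)[OF kernel_U _ G_integrable[OF assms]]) measurable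
  then show ?thesis
    by (rule integral_bounded_linear[OF mm.bounded_linear_left, symmetric])
qed

lemma kernel_lyap_hat_right:
  assumes "\<theta> \<in> {-h..0}"
  shows "matrix_kernel (lyap_hat_right \<theta>)"
  unfolding lyap_hat_right_def[abs_def]
  by (intro kernel_add kernel_mult kernel_shift kernel_U kernel_U_Khat assms)

lemma expand_lyap_hat_right:
  assumes J: "matrix_linear J" and \<theta>: "\<theta> \<in> {-h..0}"
  shows "J (lyap_hat_right \<theta>) = J (\<lambda>\<tau> M. U (\<tau> + (- \<theta> - h)) M) ** A1
    + J (\<lambda>\<tau> M. \<integral>\<delta>. U (\<tau> + (- \<theta> + \<delta>)) M ** G \<delta> \<partial>leb_on {-h..\<theta>})"
proof -
  note ks = kernel_shift[OF kernel_U, of "- \<theta> - h"]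
  show ?thesis
    using J kernel_mult(2)[OF ks, of A1] kernel_U_Khat[OF \<theta>] ks
    unfolding lyap_hat_right_def[abs_def] matrix_linear_def by simp
qed

text \<open>
  The delay Lyapunov matrix function with \<open>Khat\<close> in both factors, in terms of the version with
  \<open>Khat\<close> in the right factor only.
\<close>

definition lyap_hat_both :: "real \<Rightarrow> real \<Rightarrow> real \<Rightarrow> real^'n^'n \<Rightarrow> real^'n^'n" where
  "lyap_hat_both \<xi> \<theta> \<tau> M = transpose A1 ** lyap_hat_right \<theta> (\<tau> + (\<xi> + h)) M
     + (\<integral>\<delta>. transpose (G \<delta>) ** lyap_hat_right \<theta> (\<tau> + (\<xi> - \<delta>)) M \<partial>leb_on {-h..\<xi>})"

lemma lyap_hat_both_eq:
  assumes \<theta>: "\<theta> \<in> {-h..0}" and \<xi>: "\<xi> \<in> {-h..0}"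
  shows "lyap_hat_both \<xi> \<theta> \<tau> M =
     transpose A1 ** U (\<tau> + (\<xi> - \<theta>)) M ** A1
     + transpose A1 ** (\<integral>\<delta>. U (\<tau> + (\<xi> + h) + (- \<theta> + \<delta>)) M ** G \<delta> \<partial>leb_on {-h..\<theta>})
     + (\<integral>\<delta>. transpose (G \<delta>) ** U (\<tau> + (\<xi> - \<delta> - \<theta> - h)) M \<partial>leb_on {-h..\<xi>}) ** A1
     + (\<integral>\<delta>1. \<integral>\<delta>2. transpose (G \<delta>1) ** U (\<tau> + (\<xi> - \<delta>1) + (- \<theta> + \<delta>2)) M ** G \<delta>2 \<partial>leb_on {-h..\<theta>}
         \<partial>leb_on {-h..\<xi>})"
proof -
  let ?S = "leb_on {-h..\<theta>}" and ?X = "leb_on {-h..\<xi>}"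
  note g = G_integrable[OF \<xi>]
  have i1: "integrable ?X (\<lambda>\<delta>. transpose (G \<delta>) ** U (\<tau> + (\<xi> - \<delta> - \<theta> - h)) M)"
    by (rule kernel_weighted_integrable(2)[OF kernel_U _ g]) measurable
  have i2: "integrable ?X (\<lambda>\<delta>1. transpose (G \<delta>1) ** (\<integral>\<delta>2. U (\<tau> + (\<xi> - \<delta>1)
      + (- \<theta> + \<delta>2)) M ** G \<delta>2 \<partial>?S))"
    by (rule kernel_weighted_integrable(2)[OF kernel_U_Khat[OF \<theta>] _ g]) measurable
  have "(\<integral>\<delta>. transpose (G \<delta>) ** lyap_hat_right \<theta> (\<tau> + (\<xi> - \<delta>)) M \<partial>?X)
     = (\<integral>\<delta>. transpose (G \<delta>) ** U (\<tau> + (\<xi> - \<delta> - \<theta> - h)) M ** A1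
        + transpose (G \<delta>) ** (\<integral>\<delta>2. U (\<tau> + (\<xi> - \<delta>) + (- \<theta> + \<delta>2)) M ** G \<delta>2 \<partial>?S) \<partial>?X)"
    by (intro Bochner_Integration.integral_cong refl)
       (simp add: lyap_hat_right_def mm.add_right matrix_mul_assoc algebra_simps)
  also have "\<dots> = (\<integral>\<delta>. transpose (G \<delta>) ** U (\<tau> + (\<xi> - \<delta> - \<theta> - h)) M \<partial>?X) ** A1
      + (\<integral>\<delta>1. \<integral>\<delta>2. transpose (G \<delta>1) ** U (\<tau> + (\<xi> - \<delta>1) + (- \<theta> + \<delta>2)) M ** G \<delta>2 \<partial>?S \<partial>?X)"
    by (subst Bochner_Integration.integral_add[OF integrable_bounded_linear[OF
        mm.bounded_linear_left i1] i2])
       (simp only: integral_U_mult[OF \<xi>] mult_integral_U[OF \<theta>])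
  finally show ?thesis
    by (simp add: lyap_hat_both_def lyap_hat_right_def[of _ "\<tau> + (\<xi> + h)"]
        mm.add_right matrix_mul_assoc algebra_simps)
qed

lemma kernel_lyap_hat_both_terms:
  assumes \<theta>: "\<theta> \<in> {-h..0}" and \<xi>: "\<xi> \<in> {-h..0}"
  shows "matrix_kernel (\<lambda>\<tau> M. U (\<tau> + (\<xi> - \<theta>)) M)"
    and "matrix_kernel (\<lambda>\<tau> M. \<integral>\<delta>. U (\<tau> + (\<xi> + h) + (- \<theta> + \<delta>)) M ** G \<delta> \<partial>leb_on {-h..\<theta>})"
    and "matrix_kernel (\<lambda>\<tau> M. \<integral>\<delta>. transpose (G \<delta>) ** U (\<tau> + (\<xi> - \<delta> - \<theta> - h)) M \<partial>leb_on {-h..\<xi>})"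
    and "matrix_kernel (\<lambda>\<tau> M. \<integral>\<delta>1. \<integral>\<delta>2. transpose (G \<delta>1) ** U (\<tau> + (\<xi> - \<delta>1)
        + (- \<theta> + \<delta>2)) M ** G \<delta>2 \<partial>leb_on {-h..\<theta>} \<partial>leb_on {-h..\<xi>})"
proof -
  show "matrix_kernel (\<lambda>\<tau> M. U (\<tau> + (\<xi> - \<theta>)) M)"
    by (rule kernel_shift[OF kernel_U])
  show "matrix_kernel (\<lambda>\<tau> M. \<integral>\<delta>. U (\<tau> + (\<xi> + h) + (- \<theta> + \<delta>)) M ** G \<delta> \<partial>leb_on {-h..\<theta>})"
    by (rule kernel_shift[OF kernel_U_Khat[OF \<theta>]])
  show "matrix_kernel (\<lambda>\<tau> M. \<integral>\<delta>. transpose (G \<delta>) ** U (\<tau> + (\<xi> - \<delta> - \<theta> - h)) M \<partial>leb_on {-h..\<xi>})"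
    by (rule kernel_weighted_integral(2)[OF kernel_U sigma_finite_Icc _ G_integrable[OF \<xi>]])
        measurable
  have "matrix_kernel (\<lambda>\<tau> M. \<integral>\<delta>1. transpose (G \<delta>1) **
      (\<integral>\<delta>2. U (\<tau> + (\<xi> - \<delta>1) + (- \<theta> + \<delta>2)) M ** G \<delta>2 \<partial>leb_on {-h..\<theta>}) \<partial>leb_on {-h..\<xi>})"
    by (rule kernel_weighted_integral(2)[OF kernel_U_Khat[OF \<theta>] sigma_finite_Icc _ G_integrable[OF
        \<xi>]]) measurable
  then show "matrix_kernel (\<lambda>\<tau> M. \<integral>\<delta>1. \<integral>\<delta>2. transpose (G \<delta>1) ** U (\<tau> + (\<xi> - \<delta>1)
      + (- \<theta> + \<delta>2)) M ** G \<delta>2 \<partial>leb_on {-h..\<theta>} \<partial>leb_on {-h..\<xi>})"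
    by (simp only: mult_integral_U[OF \<theta>])
qed

text \<open>
  The four summands are those that each term of \<open>\<Pi>2\<close> contributes to the claim, one for each choice
  of the discrete or the distributed delay in the two factors.
\<close>

lemma expand_lyap_hat_both:
  assumes J: "matrix_linear J" and \<theta>: "\<theta> \<in> {-h..0}" and \<xi>: "\<xi> \<in> {-h..0}"
  shows "J (lyap_hat_both \<xi> \<theta>) =
     transpose A1 ** J (\<lambda>\<tau> M. U (\<tau> + (\<xi> - \<theta>)) M) ** A1
     + transpose A1 ** J (\<lambda>\<tau> M. \<integral>\<delta>. U (\<tau> + (\<xi> + h) + (- \<theta> + \<delta>)) M ** G \<delta> \<partial>leb_on {-h..\<theta>})
     + J (\<lambda>\<tau> M. \<integral>\<delta>. transpose (G \<delta>) ** U (\<tau> + (\<xi> - \<delta> - \<theta> - h)) M \<partial>leb_on {-h..\<xi>}) ** A1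
     + J (\<lambda>\<tau> M. \<integral>\<delta>1. \<integral>\<delta>2. transpose (G \<delta>1) ** U (\<tau> + (\<xi> - \<delta>1)
         + (- \<theta> + \<delta>2)) M ** G \<delta>2 \<partial>leb_on {-h..\<theta>} \<partial>leb_on {-h..\<xi>})"
proof -
  note k = kernel_lyap_hat_both_terms[OF \<theta> \<xi>]
  have add: "J (\<lambda>\<tau> M. \<Phi> \<tau> M + \<Psi> \<tau> M) = J \<Phi> + J \<Psi>" if "matrix_kernel \<Phi>" "matrix_kernel \<Psi>" for \<Phi> \<Psi>
    using J that by (simp add: matrix_linear_def)
  have left: "J (\<lambda>\<tau> M. A ** \<Phi> \<tau> M) = A ** J \<Phi>" and right: "J (\<lambda>\<tau> M. \<Phi> \<tau> M ** A) = J \<Phi> ** A"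
    if "matrix_kernel \<Phi>" for A \<Phi>
    using J that by (simp_all add: matrix_linear_def)
  note k1 = kernel_mult(1)[OF k(1), of "transpose A1"]
  note k1' = kernel_mult(2)[OF k1, of A1]
  note k2 = kernel_mult(1)[OF k(2), of "transpose A1"]
  note k3 = kernel_mult(2)[OF k(3), of A1]
  have "J (lyap_hat_both \<xi> \<theta>) = J (\<lambda>\<tau> M. transpose A1 ** U (\<tau> + (\<xi> - \<theta>)) M ** A1
     + transpose A1 ** (\<integral>\<delta>. U (\<tau> + (\<xi> + h) + (- \<theta> + \<delta>)) M ** G \<delta> \<partial>leb_on {-h..\<theta>})
     + (\<integral>\<delta>. transpose (G \<delta>) ** U (\<tau> + (\<xi> - \<delta> - \<theta> - h)) M \<partial>leb_on {-h..\<xi>}) ** A1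
     + (\<integral>\<delta>1. \<integral>\<delta>2. transpose (G \<delta>1) ** U (\<tau> + (\<xi> - \<delta>1) + (- \<theta> + \<delta>2)) M ** G \<delta>2 \<partial>leb_on {-h..\<theta>}
         \<partial>leb_on {-h..\<xi>}))"
    using lyap_hat_both_eq[OF \<theta> \<xi>] by presburger
  then show ?thesis
    by (simp only: add[OF kernel_add[OF kernel_add[OF k1' k2] k3] k(4)]
        add[OF kernel_add[OF k1' k2] k3]
        add[OF k1' k2] right[OF k1] left[OF k(1)] left[OF k(2)] right[OF k(3)])
qed

lemma K_Khat_correlation:
  assumes "\<theta> \<in> {-h..0}" "a \<le> 0"
  shows "(\<integral>t. transpose (K (t + a)) ** M ** Khat h A1 G K (t + s) \<theta> \<partial>half_line)
      = lyap_hat_right \<theta> (s - a) M"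
  using correlation_shift[OF Khat_measurable[OF assms(1)] assms(2)]
      by (simp add: correlation_Khat[OF assms(1)])

lemma Khat_Khat_correlation:
  assumes "\<theta> \<in> {-h..0}" "\<xi> \<in> {-h..0}" "a \<le> 0"
  shows "(\<integral>t. transpose (Khat h A1 G K (t + a) \<xi>) ** M ** Khat h A1 G K (t + s) \<theta> \<partial>half_line)
      = lyap_hat_both \<xi> \<theta> (s - a) M"
proof -
  obtain B where "\<And>t. norm (Khat h A1 G K t \<theta>) \<le> B"
    using Khat_bounded[OF assms(1)] by blast
  from correlation_left_Khat[OF assms(2,3) Khat_measurable[OF assms(1)] this]
  show ?thesis by (simp add: correlation_Khat[OF assms(1)] lyap_hat_both_def)
qed

lemma K_Khat_integrable:
  assumes "\<theta> \<in> {-h..0}"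
  shows "integrable half_line (\<lambda>t. transpose (K t) ** M ** Khat h A1 G K (t + s) \<theta>)"
proof -
  obtain B where "\<And>t. norm (Khat h A1 G K t \<theta>) \<le> B"
    using Khat_bounded[OF assms(1)] by blast
  from correlation_integrable[OF Khat_measurable[OF assms(1)] this, of 0]
  show ?thesis by simp
qed

end

section \<open>The cost matrices as values of matrix-linear functionals\<close>

lemma set_lint_Icc:
  fixes f :: "real \<Rightarrow> 'a::{banach, second_countable_topology}"
  shows "(LINT x:{a..b}|lebesgue. f x) = integral\<^sup>L (leb_on {a..b}) f"
  by (rule set_lint_leb_on) simp

lemma set_lint_Ici:
  fixes f :: "real \<Rightarrow> 'a::{banach, second_countable_topology}"
  shows "(LINT x:{a..}|lebesgue. f x) = integral\<^sup>L (leb_on {a..}) f"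
  by (rule set_lint_leb_on) simp

text \<open>
  The bound of \<open>M3\<close> by a product of integrable functions is what \<open>\<Gamma>1(\<theta>1)\<^sup>T R \<Gamma>1(\<theta>2)\<close> satisfies for
  an integrable \<open>\<Gamma>1\<close>. The arguments of \<open>M3\<close> are swapped because its second argument \<open>\<theta>2\<close> is the
  variable of the outer integral.
\<close>

locale quadratic_cost = decaying_delay K c b h A0 A1 G
  for K :: "real \<Rightarrow> real^'n^'n" and c b h :: real and A0 A1 :: "real^'n^'n"
    and G :: "real \<Rightarrow> real^'n^'n" +
  fixes M1 :: "real^'n^'n" and M2 :: "real \<Rightarrow> real^'n^'n" and M3 :: "real \<Rightarrow> real \<Rightarrow> real^'n^'n"
    and u v :: "real \<Rightarrow> real"
  assumes M2_int: "integrable delay_interval M2"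
    and M3_meas: "(\<lambda>(x, y). M3 y x) \<in> borel_measurable (delay_interval \<Otimes>\<^sub>M delay_interval)"
    and u_int: "integrable delay_interval u" and v_int: "integrable delay_interval v"
    and M3_bound: "\<And>x y. norm (M3 y x) \<le> u x * v y"
begin

text \<open>
  The ways in which the weights \<open>M1\<close>, \<open>M2\<close>, the transpose of \<open>M2\<close>, and \<open>M3\<close> act on a kernel; the
  time shift at which the kernel is read is the difference of the shifts of the two factors under
  the time integral.
\<close>

definition "single_value \<Phi> = \<Phi> 0 M1" for \<Phi> :: "real \<Rightarrow> real^'n^'n \<Rightarrow> real^'n^'n"
definition "single_integral \<Phi> = (\<integral>\<theta>. \<Phi> \<theta> (M2 \<theta>) \<partial>delay_interval)"
    for \<Phi> :: "real \<Rightarrow> real^'n^'n \<Rightarrow> real^'n^'n"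
definition "transposed_integral \<Phi> = (\<integral>\<theta>. \<Phi> (- \<theta>) (transpose (M2 \<theta>)) \<partial>delay_interval)"
    for \<Phi> :: "real \<Rightarrow> real^'n^'n \<Rightarrow> real^'n^'n"
definition "double_integral \<Phi> = (\<integral>\<theta>2. \<integral>\<theta>1. \<Phi> (\<theta>2 - \<theta>1) (M3 \<theta>1 \<theta>2) \<partial>delay_interval
    \<partial>delay_interval)" for \<Phi> :: "real \<Rightarrow> real^'n^'n \<Rightarrow> real^'n^'n"

lemma M2t_int: "integrable delay_interval (\<lambda>\<theta>. transpose (M2 \<theta>))"
  by (rule integrable_bounded_linear[OF bounded_linear_transpose M2_int])

lemma functionals_linear: "matrix_linear single_value" "matrix_linear single_integral"
    "matrix_linear transposed_integral" "matrix_linear double_integral"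
proof -
  show "matrix_linear single_value"
    unfolding single_value_def[abs_def] by (rule matrix_linear_eval)
  show "matrix_linear single_integral"
    unfolding single_integral_def[abs_def] by (rule matrix_linear_integral[OF _ M2_int]) measurable
  show "matrix_linear transposed_integral"
    unfolding transposed_integral_def[abs_def] by (rule matrix_linear_integral[OF _ M2t_int])
        measurable
  show "matrix_linear double_integral"
    unfolding double_integral_def[abs_def]
    by (rule matrix_linear_double_integral[OF sigma_finite_delay _ M3_meas u_int v_int M3_bound])
        measurable
qed

text \<open>
  In \<open>\<Pi>0\<close> the time integral is the outermost one, so here it has to be moved inside: once for \<open>M2\<close>
  and past two delay variables for \<open>M3\<close>.
\<close>

lemma Pi0_eq: "Pi0 h K M1 M2 M3 = single_value U + 2 *\<^sub>R single_integral U + double_integral U"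
proof -
  note [measurable] = borel_measurable_integrable[OF M2_int] borel_measurable_integrable[OF u_int]
    borel_measurable_integrable[OF v_int]
  note M3m [measurable] = M3_meas
  have [measurable]: "(\<lambda>x. M3 (snd x) (fst x)) \<in> borel_measurable
      (delay_interval \<Otimes>\<^sub>M delay_interval)"
    using M3m by (simp add: case_prod_beta)
  interpret SN: sigma_finite_measure delay_interval by (rule sigma_finite_delay)
  have Kenv: "norm (K (t + \<theta>)) \<le> exp (b * h) * envelope t" if "\<theta> \<in> space delay_interval" for t \<theta>
  proof -
    have "- b * \<theta> \<le> b * h"
      using that b_pos mult_left_mono[of "- \<theta>" h b] by (auto simp: space_restrict_space)
    then have "exp (- b * \<theta>) * envelope t \<le> exp (b * h) * envelope t"
      using envelope_nonneg by (intro mult_right_mono) auto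
    with K_shift_le_envelope show ?thesis by (rule order_trans)
  qed
  have J1: "(\<integral>t. transpose (K t) ** M1 ** K t \<partial>half_line) = single_value U"
    by (simp add: single_value_def correlation_K[symmetric] correlation_def)
  have J2: "(\<integral>t. \<integral>\<theta>. transpose (K t) ** M2 \<theta> ** K (t + \<theta>) \<partial>delay_interval \<partial>half_line)
      = single_integral U"
  proof -
    have "(\<integral>t. \<integral>\<theta>. transpose (K t) ** M2 \<theta> ** K (t + \<theta>) \<partial>delay_interval \<partial>half_line)
        = (\<integral>\<theta>. \<integral>t. transpose (K t) ** M2 \<theta> ** K (t + \<theta>) \<partial>half_line \<partial>delay_interval)"
    proof (rule integrable_product_dominated(2)[OF sigma_finite_half_line sigma_finite_delay _
        integrable_envelope])
      show "(\<lambda>(t, \<theta>). transpose (K t) ** M2 \<theta> ** K (t + \<theta>))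
          \<in> borel_measurable (half_line \<Otimes>\<^sub>M delay_interval)"
        by measurable
      show "integrable delay_interval (\<lambda>\<theta>. norm (M2 \<theta>) * c)"
        using M2_int by simp
      show "norm (transpose (K t) ** M2 \<theta> ** K (t + \<theta>)) \<le> envelope t * (norm (M2 \<theta>) * c)" for t \<theta>
        unfolding mult.assoc[symmetric]
        by (rule triple_bound) (use K_shift_le_envelope[of t 0] K_bound in auto)
    qed
    then show ?thesis by (simp add: single_integral_def correlation_K[symmetric] correlation_def)
  qed
  have J3: "(\<integral>t. \<integral>\<theta>2. \<integral>\<theta>1. transpose (K (t + \<theta>1)) ** M3 \<theta>1 \<theta>2 ** K (t + \<theta>2) \<partial>delay_interval
      \<partial>delay_interval \<partial>half_line) = double_integral U"
  proof -
    \<comment> \<open>Dominates K (t + \<theta>1) uniformly in \<theta>1 \<in> [-h, 0], which makes the majorants of product form.\<close>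
    define e where "e t = exp (b * h) * envelope t" for t
    have e_int: "integrable half_line e"
      unfolding e_def using integrable_envelope by simp
    have bd: "norm (transpose (K (t + \<theta>1)) ** M3 \<theta>1 \<theta>2 ** K (t + \<theta>2)) \<le> e t * (u \<theta>2 * v \<theta>1) * c"
      if "\<theta>1 \<in> space delay_interval" for t \<theta>1 \<theta>2
      by (rule triple_bound) (use Kenv[OF that] M3_bound K_bound in \<open>auto simp: e_def\<close>)
    have sect: "(\<lambda>\<theta>1. M3 \<theta>1 \<theta>2) \<in> borel_measurable delay_interval" if "\<theta>2 \<in> space delay_interval"
        for \<theta>2
      using measurable_compose[OF measurable_Pair1'[OF that] M3m] by simp
    have "(\<integral>t. \<integral>\<theta>2. \<integral>\<theta>1. transpose (K (t + \<theta>1)) ** M3 \<theta>1 \<theta>2 ** K (t + \<theta>2) \<partial>delay_interval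
        \<partial>delay_interval \<partial>half_line)
        = (\<integral>\<theta>2. \<integral>t. \<integral>\<theta>1. transpose (K (t + \<theta>1)) ** M3 \<theta>1 \<theta>2 ** K (t + \<theta>2) \<partial>delay_interval
            \<partial>half_line \<partial>delay_interval)"
    proof (rule integrable_product_dominated(2)[OF sigma_finite_half_line sigma_finite_delay _
        e_int])
      have "(\<lambda>p. \<integral>\<theta>1. transpose (K (fst p + \<theta>1)) ** M3 \<theta>1 (snd p) ** K (fst p + snd p)
          \<partial>delay_interval)
          \<in> borel_measurable (half_line \<Otimes>\<^sub>M delay_interval)"
        by measurable
      then show "(\<lambda>(t, \<theta>2). \<integral>\<theta>1. transpose (K (t + \<theta>1)) ** M3 \<theta>1 \<theta>2 ** K (t + \<theta>2) \<partial>delay_interval)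
          \<in> borel_measurable (half_line \<Otimes>\<^sub>M delay_interval)"
        by (simp add: case_prod_beta)
      show "integrable delay_interval (\<lambda>\<theta>2. u \<theta>2 * ((\<integral>\<theta>1. v \<theta>1 \<partial>delay_interval) * c))"
        using u_int by simp
      fix t \<theta>2 assume \<theta>2: "\<theta>2 \<in> space delay_interval"
      have i: "integrable delay_interval (\<lambda>\<theta>1. e t * (u \<theta>2 * v \<theta>1) * c)"
        using v_int by simp
      note [measurable] = sect[OF \<theta>2]
      have "norm (\<integral>\<theta>1. transpose (K (t + \<theta>1)) ** M3 \<theta>1 \<theta>2 ** K (t + \<theta>2) \<partial>delay_interval)
          \<le> (\<integral>\<theta>1. e t * (u \<theta>2 * v \<theta>1) * c \<partial>delay_interval)"
        by (rule Bochner_Integration.integral_norm_bound_integral[OF integrable_dominated[OF i _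
            bd] i bd]) auto
      then show "norm (\<integral>\<theta>1. transpose (K (t + \<theta>1)) ** M3 \<theta>1 \<theta>2 ** K (t + \<theta>2) \<partial>delay_interval)
          \<le> e t * (u \<theta>2 * ((\<integral>\<theta>1. v \<theta>1 \<partial>delay_interval) * c))"
        by (simp add: mult.assoc)
    qed
    also have "\<dots> = double_integral U"
      unfolding double_integral_def
    proof (rule Bochner_Integration.integral_cong[OF refl])
      fix \<theta>2 assume \<theta>2: "\<theta>2 \<in> space delay_interval"
      note [measurable] = sect[OF \<theta>2]
      have "(\<integral>t. \<integral>\<theta>1. transpose (K (t + \<theta>1)) ** M3 \<theta>1 \<theta>2 ** K (t + \<theta>2) \<partial>delay_interval \<partial>half_line)
          = (\<integral>\<theta>1. \<integral>t. transpose (K (t + \<theta>1)) ** M3 \<theta>1 \<theta>2 ** K (t + \<theta>2) \<partial>half_line \<partial>delay_interval)"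
      proof (rule integrable_product_dominated(2)[OF sigma_finite_half_line sigma_finite_delay _
          e_int])
        show "(\<lambda>(t, \<theta>1). transpose (K (t + \<theta>1)) ** M3 \<theta>1 \<theta>2 ** K (t + \<theta>2))
            \<in> borel_measurable (half_line \<Otimes>\<^sub>M delay_interval)"
          by measurable
        show "integrable delay_interval (\<lambda>\<theta>1. u \<theta>2 * v \<theta>1 * c)"
          using v_int by simp
        show "norm (transpose (K (t + \<theta>1)) ** M3 \<theta>1 \<theta>2 ** K (t + \<theta>2)) \<le> e t * (u \<theta>2 * v \<theta>1 * c)"
          if "\<theta>1 \<in> space delay_interval" for t \<theta>1
          using bd[OF that] by (simp add: mult.assoc)
      qed
      also have "\<dots> = (\<integral>\<theta>1. U (\<theta>2 - \<theta>1) (M3 \<theta>1 \<theta>2) \<partial>delay_interval)"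
        by (intro Bochner_Integration.integral_cong refl)
           (simp add: correlation_shift correlation_K space_restrict_space)
      finally show "(\<integral>t. \<integral>\<theta>1. transpose (K (t + \<theta>1)) ** M3 \<theta>1 \<theta>2 ** K (t + \<theta>2) \<partial>delay_interval
          \<partial>half_line)
          = (\<integral>\<theta>1. U (\<theta>2 - \<theta>1) (M3 \<theta>1 \<theta>2) \<partial>delay_interval)" .
    qed
    finally show ?thesis .
  qed
  show ?thesis
    unfolding Pi0_def set_lint_Icc set_lint_Ici J1 J2 J3 ..
qed

lemma Pi1_eq:
  assumes \<theta>: "\<theta> \<in> {-h..0}"
  shows "Pi1 h A1 G K M1 M2 M3 \<theta> = single_value (lyap_hat_right \<theta>)
      + (single_integral (lyap_hat_right \<theta>) + transposed_integral
      (lyap_hat_right \<theta>)) + double_integral (lyap_hat_right \<theta>)"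
proof -
  have J1: "(\<integral>t. transpose (K t) ** M1 ** Khat h A1 G K t \<theta> \<partial>half_line)
      = single_value (lyap_hat_right \<theta>)"
    using K_Khat_correlation[OF \<theta>, of 0 M1 0] by (simp add: single_value_def)
  have "(\<integral>t. transpose (K t) ** (M2 \<theta>2 ** Khat h A1 G K (t + \<theta>2) \<theta>
           + transpose (M2 \<theta>2) ** Khat h A1 G K (t - \<theta>2) \<theta>) \<partial>half_line)
      = lyap_hat_right \<theta> \<theta>2 (M2 \<theta>2) + lyap_hat_right \<theta> (- \<theta>2) (transpose (M2 \<theta>2))" for \<theta>2
    using K_Khat_integrable[OF \<theta>, of "M2 \<theta>2" \<theta>2] K_Khat_integrable[OF \<theta>, of "transpose
        (M2 \<theta>2)" "- \<theta>2"]
      K_Khat_correlation[OF \<theta>, of 0 "M2 \<theta>2" \<theta>2] K_Khat_correlation[OF \<theta>, of 0 "transpose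
          (M2 \<theta>2)" "- \<theta>2"]
    by (simp add: mm.add_right matrix_mul_assoc)
  moreover have "integrable delay_interval (\<lambda>\<theta>2. lyap_hat_right \<theta> \<theta>2 (M2 \<theta>2))"
    by (rule kernel_integrable[OF kernel_lyap_hat_right[OF \<theta>] _ M2_int]) measurable
  moreover have "integrable delay_interval (\<lambda>\<theta>2. lyap_hat_right \<theta> (- \<theta>2) (transpose (M2 \<theta>2)))"
    by (rule kernel_integrable[OF kernel_lyap_hat_right[OF \<theta>] _ M2t_int]) measurable
  ultimately have J2: "(\<integral>\<theta>2. \<integral>t. transpose (K t) ** (M2 \<theta>2 ** Khat h A1 G K (t + \<theta>2) \<theta>
           + transpose (M2 \<theta>2) ** Khat h A1 G K (t - \<theta>2) \<theta>) \<partial>half_line \<partial>delay_interval)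
               = single_integral (lyap_hat_right \<theta>) + transposed_integral (lyap_hat_right \<theta>)"
    by (simp add: single_integral_def transposed_integral_def)
  have J3: "(\<integral>\<theta>2. \<integral>\<theta>1. \<integral>t. transpose (K (t + \<theta>1)) ** M3 \<theta>1 \<theta>2 ** Khat h A1 G K (t + \<theta>2) \<theta>
      \<partial>half_line \<partial>delay_interval \<partial>delay_interval) = double_integral (lyap_hat_right \<theta>)"
    unfolding double_integral_def
    by (intro Bochner_Integration.integral_cong refl K_Khat_correlation \<theta>)
        (simp add: space_restrict_space)
  show ?thesis
    unfolding Pi1_def set_lint_Icc set_lint_Ici J1 J2 J3 ..
qed

lemma Pi2_eq:
  assumes \<theta>: "\<theta> \<in> {-h..0}" and \<xi>: "\<xi> \<in> {-h..0}"
  shows "Pi2 h A1 G K M1 M2 M3 \<xi> \<theta> = single_value (lyap_hat_both \<xi> \<theta>) + 2 *\<^sub>R single_integral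
      (lyap_hat_both \<xi> \<theta>) + double_integral (lyap_hat_both \<xi> \<theta>)"
proof -
  have J1: "(\<integral>t. transpose (Khat h A1 G K t \<xi>) ** M1 ** Khat h A1 G K t \<theta> \<partial>half_line)
      = single_value (lyap_hat_both \<xi> \<theta>)"
    using Khat_Khat_correlation[OF \<theta> \<xi>, of 0 M1 0] by (simp add: single_value_def)
  have J2: "(\<integral>\<theta>2. \<integral>t. transpose (Khat h A1 G K t \<xi>) ** M2 \<theta>2 ** Khat h A1 G K (t + \<theta>2) \<theta>
      \<partial>half_line \<partial>delay_interval) = single_integral (lyap_hat_both \<xi> \<theta>)"
    using Khat_Khat_correlation[OF \<theta> \<xi>, of 0] by (simp add: single_integral_def)
  have J3: "(\<integral>\<theta>2. \<integral>\<theta>1. \<integral>t. transpose (Khat h A1 G K (t + \<theta>1) \<xi>) ** M3 \<theta>1 \<theta>2 ** Khat h A1 G K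
      (t + \<theta>2) \<theta> \<partial>half_line \<partial>delay_interval \<partial>delay_interval)
      = double_integral (lyap_hat_both \<xi> \<theta>)"
    unfolding double_integral_def
    by (intro Bochner_Integration.integral_cong refl Khat_Khat_correlation \<theta> \<xi>)
        (simp add: space_restrict_space)
  show ?thesis
    unfolding Pi2_def set_lint_Icc set_lint_Ici J1 J2 J3 ..
qed

end

section \<open>The representation of the cost matrices\<close>

theorem proposition2:
  fixes h :: real
    and A B A0 A1 Q :: "real^'n^'n"
    and D :: "real^'r^'n"
    and R :: "real^'r^'r"
    and E G K :: "real \<Rightarrow> real^'n^'n"
    and \<Gamma>0 :: "real^'n^'r"
    and \<Gamma>1 :: "real \<Rightarrow> real^'n^'r"
    and M1 :: "real^'n^'n"
    and M2 :: "real \<Rightarrow> real^'n^'n"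
    and M3 :: "real \<Rightarrow> real \<Rightarrow> real^'n^'n"
    and U :: "real \<Rightarrow> real^'n^'n \<Rightarrow> real^'n^'n"
  assumes "h > 0"
    and "continuous_on {-h..0} E"
    and "set_integrable lebesgue {-h..0} \<Gamma>1"
    and "sym_pos_def Q" and "sym_pos_def R"
    and "A0 = A + D ** \<Gamma>0"
    and "A1 = B"
    and "G = (\<lambda>\<theta>. E \<theta> + D ** \<Gamma>1 \<theta>)"
    and "exp_stable h A0 A1 G"
    and "fundamental_matrix h A0 A1 G K"
    and "U = lyap_matrix K"
    and "M1 = Q + transpose \<Gamma>0 ** R ** \<Gamma>0"
    and "M2 = (\<lambda>\<theta>. transpose \<Gamma>0 ** R ** \<Gamma>1 \<theta>)"
    and "M3 = (\<lambda>\<theta>1 \<theta>2. transpose (\<Gamma>1 \<theta>1) ** R ** \<Gamma>1 \<theta>2)"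
  shows
    "Pi0 h K M1 M2 M3 =
       U 0 M1
       + 2 *\<^sub>R (LINT \<theta>:{-h..0}|lebesgue. U \<theta> (M2 \<theta>))
       + (LINT \<theta>2:{-h..0}|lebesgue. LINT \<theta>1:{-h..0}|lebesgue. U (- \<theta>1 + \<theta>2) (M3 \<theta>1 \<theta>2))
     \<and> (\<forall>\<theta>\<in>{-h..0}. Pi1 h A1 G K M1 M2 M3 \<theta> =
       U (- \<theta> - h) M1 ** A1
       + (LINT \<delta>:{-h..\<theta>}|lebesgue. U (- \<theta> + \<delta>) M1 ** G \<delta>)
       + (LINT \<theta>2:{-h..0}|lebesgue. U (\<theta>2 - \<theta> - h) (M2 \<theta>2)) ** A1
       + (LINT \<theta>2:{-h..0}|lebesgue. U (- \<theta>2 - \<theta> - h) (transpose (M2 \<theta>2))) ** A1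
       + (LINT \<theta>2:{-h..0}|lebesgue. LINT \<delta>:{-h..\<theta>}|lebesgue.
            U (\<theta>2 - \<theta> + \<delta>) (M2 \<theta>2) ** G \<delta>)
       + (LINT \<theta>2:{-h..0}|lebesgue. LINT \<delta>:{-h..\<theta>}|lebesgue.
            U (- \<theta>2 - \<theta> + \<delta>) (transpose (M2 \<theta>2)) ** G \<delta>)
       + (LINT \<theta>2:{-h..0}|lebesgue. LINT \<theta>1:{-h..0}|lebesgue.
            U (- \<theta>1 + \<theta>2 - \<theta> - h) (M3 \<theta>1 \<theta>2)) ** A1
       + (LINT \<theta>2:{-h..0}|lebesgue. LINT \<theta>1:{-h..0}|lebesgue. LINT \<delta>:{-h..\<theta>}|lebesgue.
            U (- \<theta>1 + \<theta>2 - \<theta> + \<delta>) (M3 \<theta>1 \<theta>2) ** G \<delta>))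
     \<and> (\<forall>\<xi>\<in>{-h..0}. \<forall>\<theta>\<in>{-h..0}. Pi2 h A1 G K M1 M2 M3 \<xi> \<theta> =
       transpose A1 ** U (\<xi> - \<theta>) M1 ** A1
       + transpose A1 ** (LINT \<delta>:{-h..\<theta>}|lebesgue. U (\<xi> + h - \<theta> + \<delta>) M1 ** G \<delta>)
       + (LINT \<delta>:{-h..\<xi>}|lebesgue. transpose (G \<delta>) ** U (\<xi> - \<delta> - \<theta> - h) M1 ** A1)
       + (LINT \<delta>1:{-h..\<xi>}|lebesgue. LINT \<delta>2:{-h..\<theta>}|lebesgue.
            transpose (G \<delta>1) ** U (\<xi> - \<theta> - \<delta>1 + \<delta>2) M1 ** G \<delta>2)
       + 2 *\<^sub>R (transpose A1 ** (LINT \<theta>2:{-h..0}|lebesgue. U (\<xi> + \<theta>2 - \<theta>) (M2 \<theta>2)) ** A1)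
       + 2 *\<^sub>R (transpose A1 ** (LINT \<theta>2:{-h..0}|lebesgue. LINT \<delta>:{-h..\<theta>}|lebesgue.
            U (\<xi> + h + \<theta>2 - \<theta> + \<delta>) (M2 \<theta>2) ** G \<delta>))
       + 2 *\<^sub>R ((LINT \<theta>2:{-h..0}|lebesgue. LINT \<delta>:{-h..\<xi>}|lebesgue.
            transpose (G \<delta>) ** U (\<xi> - \<delta> + \<theta>2 - \<theta> - h) (M2 \<theta>2)) ** A1)
       + 2 *\<^sub>R (LINT \<theta>2:{-h..0}|lebesgue. LINT \<delta>1:{-h..\<xi>}|lebesgue. LINT \<delta>2:{-h..\<theta>}|lebesgue.
            transpose (G \<delta>1) ** U (\<xi> - \<delta>1 + \<theta>2 - \<theta> + \<delta>2) (M2 \<theta>2) ** G \<delta>2)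
       + transpose A1 ** (LINT \<theta>2:{-h..0}|lebesgue. LINT \<theta>1:{-h..0}|lebesgue.
            U (- \<theta>1 + \<xi> + \<theta>2 - \<theta>) (M3 \<theta>1 \<theta>2)) ** A1
       + transpose A1 ** (LINT \<theta>2:{-h..0}|lebesgue. LINT \<theta>1:{-h..0}|lebesgue. LINT \<delta>:{-h..\<theta>}|lebesgue.
            U (- \<theta>1 + \<xi> + h + \<theta>2 - \<theta> + \<delta>) (M3 \<theta>1 \<theta>2) ** G \<delta>)
       + (LINT \<theta>2:{-h..0}|lebesgue. LINT \<theta>1:{-h..0}|lebesgue. LINT \<delta>:{-h..\<xi>}|lebesgue.
            transpose (G \<delta>) ** U (- \<theta>1 + \<xi> - \<delta> + \<theta>2 - \<theta> - h) (M3 \<theta>1 \<theta>2)) ** A1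
       + (LINT \<theta>2:{-h..0}|lebesgue. LINT \<theta>1:{-h..0}|lebesgue. LINT \<delta>1:{-h..\<xi>}|lebesgue.
            LINT \<delta>2:{-h..\<theta>}|lebesgue.
            transpose (G \<delta>1) ** U (- \<theta>1 + \<xi> - \<delta>1 + \<theta>2 - \<theta> + \<delta>2) (M3 \<theta>1 \<theta>2) ** G \<delta>2))"
proof -
  have E_int: "set_integrable lebesgue {-h..0} E"
    using absolutely_integrable_continuous_real[OF assms(2)] .
  have \<Gamma>_int: "integrable (leb_on {-h..0}) \<Gamma>1"
    using assms(3) by (simp add: set_integrable_leb_on)
  then have \<Gamma>_meas [measurable]: "\<Gamma>1 \<in> borel_measurable (leb_on {-h..0})"
    by (rule borel_measurable_integrable)
  have G_int: "integrable (leb_on {-h..0}) G"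
    unfolding assms(8)
    using E_int integrable_bounded_linear[OF mm.bounded_linear_right \<Gamma>_int]
    by (intro Bochner_Integration.integrable_add) (simp_all add: set_integrable_leb_on)
  interpret fundamental_system h A0 A1 G K
    by unfold_locales (use assms(1,10) G_int in auto)
  obtain c b where cb: "c > 0" "b > 0" "\<And>t. norm (K t) \<le> c * exp (- b * t)"
    using exponential_decay[OF assms(9)] by blast
  have M2_int: "integrable (leb_on {-h..0}) M2"
    unfolding assms(13) by (rule integrable_bounded_linear[OF mm.bounded_linear_right \<Gamma>_int])
  have M3_meas: "(\<lambda>(x, y). M3 y x) \<in> borel_measurable (leb_on {-h..0} \<Otimes>\<^sub>M leb_on {-h..0})"
    unfolding assms(14) by measurable
  have M3_bound: "norm (M3 y x) \<le> (norm R * norm (\<Gamma>1 x)) * norm (\<Gamma>1 y)" for x y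
    unfolding assms(14) using norm_mult3_le[of "transpose (\<Gamma>1 y)" R "\<Gamma>1 x"]
    by (simp add: ac_simps)
  interpret quadratic_cost K c b h A0 A1 G M1 M2 M3 "\<lambda>x. norm R * norm (\<Gamma>1 x)" "\<lambda>y. norm (\<Gamma>1 y)"
    by unfold_locales
       (use causal_measurable[OF causal_K] K_neg cb M2_int M3_meas M3_bound \<Gamma>_int in auto)
  have U: "U = lyap_matrix K" by fact
  note J = single_value_def single_integral_def transposed_integral_def double_integral_def
  note W = functionals_linear[THEN expand_lyap_hat_right]
  note Z = functionals_linear[THEN expand_lyap_hat_both]
  show ?thesis
    unfolding U set_lint_Icc
    apply (intro conjI ballI)
    subgoal by (simp add: Pi0_eq J)
    subgoal for \<theta>
      by (simp only: Pi1_eq W, simp add: J algebra_simps)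
    subgoal for \<xi> \<theta>
      \<comment> \<open>In the \<open>M1\<close> part of the claim one last factor \<open>A1\<close> stands inside the integral.\<close>
      using integral_U_mult[of \<xi> 0 \<theta> M1 A1]
      by (simp only: Pi2_eq Z, simp add: J algebra_simps)
    done
qed

end
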